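(* Let $k\ge 0$ and $l\ge 0$. The system satisfies the data-driven distributionally robust CVaR constraints at prediction step $l+1$, that is, for every reachable error $e_{l|k}\in\bigoplus_{i=0}^{l-1}\Phi^i\mathbb{W}$ and every $i\in\{1,\dots,p\}$, $$\sup_{\mathbb{P}\in\mathcal{D}^{(k)}}\ \mathbb{P}\text{-CVaR}_{[\varepsilon]_i}\big([H]_i x_{l+1|k}-[h]_i\big)\le 0,\qquad x_{l+1|k}=z_{l+1|k}+\Phi e_{l|k}+w_{l|k},\quad w_{l|k}\sim\mathbb{P},$$ if and only if the nominal state satisfies the tightened constraint $$z_{l+1|k}\in\tilde{\mathbb{Z}}^{(k)}\ominus\Big(\bigoplus_{i=1}^{l}\Phi^i\mathbb{W}\Big),\qquad \tilde{\mathbb{Z}}^{(k)}=\{z\in\mathbb{R}^n\mid Hz\le h-\eta^{(k)}\},$$ where, for each $i$, $[\eta^{(k)}]_i$ is the optimal objective value of the following semidefinite program, in the variables $\eta,\beta_i\in\mathbb{R}$ and, for $j=1,\dots,m$, $t_{ij}\in\mathbb{R}$, $\omega_{ij}\in\mathbb{R}^n$, symmetric $\Omega_{ij}\in\mathbb{R}^{n\times n}$, and vectors $\varphi_{ij},\phi_{ij}$ of the same dimension as $f$ (the superscript $(k)$ on $m,\gamma_j,\mu_j,\Sigma_j$ is dropped): $$\begin{aligned} \min\ &\eta\\ \text{s.t. }\ &[\varepsilon]_i\beta_i+\sum_{j=1}^m\gamma_j\big\{t_{ij}+\mu_j^T\omega_{ij}+(\Sigma_j+\mu_j\mu_j^T)\bullet\Omega_{ij}\big\}\le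 0,\\ &\begin{pmatrix}\Omega_{ij}&\tfrac12(\omega_{ij}+E^T\varphi_{ij})\\ \tfrac12(\omega_{ij}+E^T\varphi_{ij})^T&t_{ij}-f^T\varphi_{ij}\end{pmatrix}\succeq 0,\quad j=1,\dots,m,\\ &\begin{pmatrix}\Omega_{ij}&\tfrac12(\omega_{ij}-[H]_i^T+E^T\phi_{ij})\\ \tfrac12(\omega_{ij}-[H]_i^T+E^T\phi_{ij})^T&t_{ij}+\beta_i+\eta-f^T\phi_{ij}\end{pmatrix}\succeq 0,\quad j=1,\dots,m,\\ &\Omega_{ij}\succeq 0,\ \varphi_{ij}\ge 0,\ \phi_{ij}\ge 0,\quad j=1,\dots,m. \end{aligned}$$
   Context: Notation: $[A]_i$ is the $i$-th row of a matrix, $[a]_i$ the $i$-th entry of a vector; $A\bullet B$ is the Frobenius inner product; $\oplus$ is the Minkowski sum and $\mathbb{A}\ominus\mathbb{B}=\{a\mid a\oplus\mathbb{B}\subseteq\mathbb{A}\}$ the Pontryagin difference; an empty Minkowski sum is $\{0\}$; $(\alpha)^+=\max(\alpha,0)$; inequalities between vectors are entrywise; $\succeq$ is the Loewner order. System: $x_{k+1}=Ax_k+Bu_k+w_k$ with $x_k\in\mathbb{R}^n$, $u_k\in\mathbb{R}^m$, $(A,B)$ controllable. The disturbance takes values in the bounded convex set $\mathbb{W}=\{w\in\mathbb{R}^n\mid Ew\le f\}$, which contains the origin in its interior. $K$ is a feedback gain such that $\Phi=A+BK$ is Schur stable. Prediction at time $k$: $x_{l+1|k}=Ax_{l|k}+Bu_{l|k}+w_{l|k}$,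 $x_{0|k}=x_k$. Split $x_{l|k}=z_{l|k}+e_{l|k}$ and use $u_{l|k}=Ke_{l|k}+v_{l|k}$, with nominal dynamics $z_{l+1|k}=Az_{l|k}+Bv_{l|k}$, $z_{0|k}=x_k$, and error dynamics $e_{l+1|k}=\Phi e_{l|k}+w_{l|k}$, $e_{0|k}=0$. The CVaR constraint on $x_{l+1|k}$ is conditional on $x_{l|k}$ (one step ahead) and is required for every reachable $e_{l|k}$, i.e. every $e_{l|k}\in\bigoplus_{i=0}^{l-1}\Phi^i\mathbb{W}$. State constraint data: $H\in\mathbb{R}^{p\times n}$, $h\in\mathbb{R}^p$, risk levels $[\varepsilon]_i\in(0,1)$. CVaR: for a loss $L$ and random vector $\tilde\xi$ with law $\mathbb{P}$, $\mathbb{P}\text{-CVaR}_\epsilon(L(\tilde\xi))=\inf_{\beta\in\mathbb{R}}\{\beta+\frac1\epsilon\mathbb{E}_{\mathbb{P}}[(L(\tilde\xi)-\beta)^+]\}$. Ambiguity set at time $k$: $\mathcal{D}^{(k)}=\sum_{j=1}^{m^{(k)}}\gamma_j^{(k)}\mathcal{D}_j(\mathbb{W},\mu_j^{(k)},\Sigma_j^{(k)})$, the weighted Minkowski sum $\{\sum_j\gamma_j^{(k)}\rho_j\mid\rho_j\in\mathcal{D}_j\}$, where $m^{(k)}$ is a number of mixture components, $\gamma_j^{(k)}$ are mixing weights (nonnegative, summing to one), $\mu_j^{(k)}\in\mathbb{R}^n$ and $\Sigma_j^{(k)}\in\mathbb{R}^{n\times n}$ are the mean and covariance estimates of component $j$,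 and $$\mathcal{D}_j(\mathbb{W},\mu_j,\Sigma_j)=\Big\{\rho\in\mathcal{M}_+\ \Big|\ \int_{\mathbb{W}}\rho(d\xi)=1,\ \int_{\mathbb{W}}\xi\,\rho(d\xi)=\mu_j,\ \int_{\mathbb{W}}\xi\xi^T\rho(d\xi)\preceq\Sigma_j+\mu_j\mu_j^T\Big\},$$ with $\mathcal{M}_+$ the positive Borel measures on $\mathbb{R}^n$ (here supported on $\mathbb{W}$). The parameters $m^{(k)},\gamma_j^{(k)},\mu_j^{(k)},\Sigma_j^{(k)}$ are regarded as given data (in practice produced by online learning from disturbance data).
   Formalization: The formal theorem additionally assumes that every component with mixing weight zero has a nonempty ambiguity set; otherwise the mixture set is empty and the CVaR constraint vacuous, while the semidefinite program ignores that component, so the equivalence fails. *)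

theory Defs
  imports "HOL-Analysis.Analysis"
begin

text \<open>
  Vectors and matrices are those of HOL-Analysis. On \<^typ>\<open>real^'n^'n\<close> the library inner
  product \<open>A \<bullet> B\<close> is the Frobenius inner product, on \<^typ>\<open>real^'n\<close> the order \<open>\<le>\<close> is entrywise,
  and \<open>H $ i\<close> is the i-th row of H. On sets, \<open>+\<close> and \<open>\<Sum>\<close> are Minkowski sums (Set_Algebras),
  so that an empty sum is \<open>{0}\<close>.
\<close>

section \<open>Linear systems\<close>

primrec mat_power :: "real^'n^'n \<Rightarrow> nat \<Rightarrow> real^'n^'n" where
  "mat_power A 0 = mat 1"
| "mat_power A (Suc k) = A ** mat_power A k"

primrec trajectory ::
  "real^'n^'n \<Rightarrow> real^'u^'n \<Rightarrow> (nat \<Rightarrow> real^'u) \<Rightarrow> real^'n \<Rightarrow> nat \<Rightarrow> real^'n" where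
  "trajectory A B u x0 0 = x0"
| "trajectory A B u x0 (Suc k) = A *v trajectory A B u x0 k + B *v u k"

definition controllable :: "real^'n^'n \<Rightarrow> real^'u^'n \<Rightarrow> bool" where
  "controllable A B \<longleftrightarrow> (\<forall>x0 x1. \<exists>u N. trajectory A B u x0 N = x1)"

text \<open>All complex eigenvalues lie in the open unit disc.\<close>

definition schur_stable :: "real^'n^'n \<Rightarrow> bool" where
  "schur_stable A \<longleftrightarrow>
     (\<forall>c (y :: complex^'n). y \<noteq> 0 \<and> map_matrix complex_of_real A *v y = c *s y \<longrightarrow> cmod c < 1)"

definition pontryagin_diff :: "'a::plus set \<Rightarrow> 'a set \<Rightarrow> 'a set" where
  "pontryagin_diff S T = {a. {a} + T \<subseteq> S}"

definition polyhedron_of :: "real^'n^'q \<Rightarrow> real^'q \<Rightarrow> (real^'n) set" where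
  "polyhedron_of E f = {w. E *v w \<le> f}"

section \<open>Positive semidefinite matrices\<close>

definition psd :: "real^'n^'n \<Rightarrow> bool" where
  "psd M \<longleftrightarrow> transpose M = M \<and> (\<forall>x. 0 \<le> x \<bullet> (M *v x))"

definition loewner_le :: "real^'n^'n \<Rightarrow> real^'n^'n \<Rightarrow> bool" where
  "loewner_le M N \<longleftrightarrow> psd (N - M)"

definition outer :: "real^'n \<Rightarrow> real^'n \<Rightarrow> real^'n^'n" where
  "outer a b = (\<chi> i j. a $ i * b $ j)"

text \<open>The symmetric block matrix with blocks M, v, the transpose of v, and the scalar c;
  the right summand of the index type is the last row and column.\<close>

definition bordered :: "real^'n^'n \<Rightarrow> real^'n \<Rightarrow> real \<Rightarrow> real^('n + unit)^('n + unit)" where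
  "bordered M v c = (\<chi> i j.
     case i of
       Inl a \<Rightarrow> (case j of Inl b \<Rightarrow> M $ a $ b | Inr _ \<Rightarrow> v $ a)
     | Inr _ \<Rightarrow> (case j of Inl b \<Rightarrow> v $ b | Inr _ \<Rightarrow> c))"

section \<open>Conditional value-at-risk and the ambiguity set\<close>

text \<open>The loss L is applied to a random vector with law P. The expectation of the nonnegative
  excess is a nonnegative Lebesgue integral and the infimum is taken in the extended reals,
  so the definition needs no integrability side condition.\<close>

definition CVaR :: "'a measure \<Rightarrow> real \<Rightarrow> ('a \<Rightarrow> real) \<Rightarrow> ereal" where
  "CVaR P \<epsilon> L =
     (INF \<beta>::real. ereal \<beta> + ereal (1 / \<epsilon>) * enn2ereal (\<integral>\<^sup>+ \<xi>. ennreal (max (L \<xi> - \<beta>) 0) \<partial>P))"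

definition component_set ::
  "(real^'n) set \<Rightarrow> real^'n \<Rightarrow> real^'n^'n \<Rightarrow> (real^'n) measure set" where
  "component_set W \<mu> S = {\<rho>. sets \<rho> = sets borel \<and> emeasure \<rho> (- W) = 0 \<and>
     emeasure \<rho> W = 1 \<and>
     (LINT \<xi>:W|\<rho>. \<xi>) = \<mu> \<and>
     loewner_le (LINT \<xi>:W|\<rho>. outer \<xi> \<xi>) (S + outer \<mu> \<mu>)}"

text \<open>Weighted Minkowski sum; the mixture of measures is described by its values on Borel sets.
  Components are indexed by \<open>j < m\<close>.\<close>

definition ambiguity_set ::
  "(real^'n) set \<Rightarrow> nat \<Rightarrow> (nat \<Rightarrow> real) \<Rightarrow> (nat \<Rightarrow> real^'n) \<Rightarrow> (nat \<Rightarrow> real^'n^'n) \<Rightarrow>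
   (real^'n) measure set" where
  "ambiguity_set W m \<gamma> \<mu> S = {P. sets P = sets borel \<and>
     (\<exists>\<rho>. (\<forall>j<m. \<rho> j \<in> component_set W (\<mu> j) (S j)) \<and>
          (\<forall>X\<in>sets borel. emeasure P X = (\<Sum>j<m. ennreal (\<gamma> j) * emeasure (\<rho> j) X)))}"

section \<open>The semidefinite program\<close>

text \<open>\<open>a\<close> is the row of the constraint matrix and \<open>\<epsilon>\<close> the risk level.
  The two multipliers \<open>\<phi>\<close> and \<open>\<psi>\<close> belong to the first and second block constraint.\<close>

definition sdp_feasible ::
  "real^'n^'q \<Rightarrow> real^'q \<Rightarrow> nat \<Rightarrow> (nat \<Rightarrow> real) \<Rightarrow> (nat \<Rightarrow> real^'n) \<Rightarrow> (nat \<Rightarrow> real^'n^'n) \<Rightarrow>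
   real^'n \<Rightarrow> real \<Rightarrow>
   real \<Rightarrow> real \<Rightarrow> (nat \<Rightarrow> real) \<Rightarrow> (nat \<Rightarrow> real^'n) \<Rightarrow> (nat \<Rightarrow> real^'n^'n) \<Rightarrow>
   (nat \<Rightarrow> real^'q) \<Rightarrow> (nat \<Rightarrow> real^'q) \<Rightarrow> bool" where
  "sdp_feasible E f m \<gamma> \<mu> S a \<epsilon> \<eta> \<beta> t \<omega> \<Omega> \<phi> \<psi> \<longleftrightarrow>
     \<epsilon> * \<beta> + (\<Sum>j<m. \<gamma> j * (t j + \<mu> j \<bullet> \<omega> j + (S j + outer (\<mu> j) (\<mu> j)) \<bullet> \<Omega> j)) \<le> 0 \<and>
     (\<forall>j<m.
        psd (bordered (\<Omega> j) ((1/2) *\<^sub>R (\<omega> j + transpose E *v \<phi> j)) (t j - f \<bullet> \<phi> j)) \<and>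
        psd (bordered (\<Omega> j) ((1/2) *\<^sub>R (\<omega> j - a + transpose E *v \<psi> j))
               (t j + \<beta> + \<eta> - f \<bullet> \<psi> j)) \<and>
        psd (\<Omega> j) \<and> 0 \<le> \<phi> j \<and> 0 \<le> \<psi> j)"

text \<open>The optimal value in the extended reals: it need not be attained, and it is \<open>- \<infinity>\<close> if the
  program is unbounded.\<close>

definition sdp_value ::
  "real^'n^'q \<Rightarrow> real^'q \<Rightarrow> nat \<Rightarrow> (nat \<Rightarrow> real) \<Rightarrow> (nat \<Rightarrow> real^'n) \<Rightarrow> (nat \<Rightarrow> real^'n^'n) \<Rightarrow>
   real^'n \<Rightarrow> real \<Rightarrow> ereal" where
  "sdp_value E f m \<gamma> \<mu> S a \<epsilon> =
     Inf (ereal ` {\<eta>. \<exists>\<beta> t \<omega> \<Omega> \<phi> \<psi>. sdp_feasible E f m \<gamma> \<mu> S a \<epsilon> \<eta> \<beta> t \<omega> \<Omega> \<phi> \<psi>})"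

definition tightened_set :: "real^'n^'p \<Rightarrow> real^'p \<Rightarrow> ('p \<Rightarrow> ereal) \<Rightarrow> (real^'n) set" where
  "tightened_set H h \<eta> = {z. \<forall>i. ereal ((H *v z) $ i) \<le> ereal (h $ i) - \<eta> i}"

end

(* CVaR is the infimum over tau of tau + E (a . xi - tau)^+ / epsilon. Finitely supported
   laws are enough for the lower bound. Since W is compact, separating the convex hull of the points
   (xi, xi xi^T, (a . xi - tau)^+) from the admissible moments gives, without a Slater condition and up
   to an arbitrarily small error, a quadratic majorant of the excess whose moments price the worst case
   of each component. Nonnegativity of a convex quadratic on W is certified by multipliers from Farkas'
   lemma at a minimiser, which turns the majorant into the two block constraints. Supremum over laws and
   infimum over tau are exchanged by a minimax argument on the line. If some mean lies outside W, its
   weight is positive, the ambiguity set is empty and the program is unbounded, so both sides are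
   minus infinity. Finally the error tube for l steps, mapped by Phi, is the tube summed from 1 to l. *)
theory Submission
  imports Defs
begin

section \<open>Positive semidefinite matrices\<close>

text \<open>The program's \<open>\<beta>\<close> is the CVaR threshold measured from the bound: with
  \<open>\<tau> = \<beta> + \<eta>\<close> the cost row reads \<tau> + (1/\<epsilon>) * (weighted
  price) \<le> \<eta>, and the two blocks of a component say that one quadratic dominates both 0 and
  a . xi - \<tau> on W. All components share the same \<tau>, so the supremum over mixtures splits
  into separate moment problems only once \<tau> is fixed; hence the minimax exchange has to precede
  the moment duality. A mean may lie on the boundary of W and a covariance bound may be singular, so
  neither strict feasibility nor attainment can be expected. Each real bound c is therefore matched
  with feasibility at c + \<delta> for every \<delta> > 0. What keeps the separation from
  degenerating is the point mass at the mean: it is an admissible law as soon as the mean lies in W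
  and S is psd. For psd S a component set is thus empty only if its mean leaves W.\<close>

lemma inner_outer: "M \<bullet> outer x y = x \<bullet> (M *v y)"
  by (simp add: inner_vec_def outer_def matrix_vector_mult_def sum_distrib_left sum_distrib_right ac_simps)

lemma outer_mult_vec: "outer a b *v y = (b \<bullet> y) *\<^sub>R a"
  by (simp add: vec_eq_iff outer_def matrix_vector_mult_def inner_vec_def sum_distrib_left sum_distrib_right ac_simps)

lemma psd_symD: "psd M \<Longrightarrow> x \<bullet> (M *v y) = y \<bullet> (M *v x)"
  by (metis dot_lmul_matrix inner_commute psd_def transpose_matrix_vector)

lemma psd_quad: "psd M \<Longrightarrow> 0 \<le> x \<bullet> (M *v x)"
  by (simp add: psd_def)

lemma psd_0 [simp]: "psd 0"
  by (simp add: psd_def transpose_def vec_eq_iff)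

lemma psd_outer: "psd (outer x x)"
proof -
  have "transpose (outer x x) = outer x x"
    by (simp add: transpose_def outer_def vec_eq_iff)
  then show ?thesis by (simp add: psd_def outer_mult_vec inner_commute[of _ x])
qed

lemma transpose_linear:
  "transpose (M + N) = transpose M + transpose N" "transpose (c *\<^sub>R M) = c *\<^sub>R transpose M"
  "transpose (M - N) = transpose M - transpose N"
  for M N :: "real^'n^'m"
  by (simp_all add: transpose_def vec_eq_iff)

lemma psd_add: "psd M \<Longrightarrow> psd N \<Longrightarrow> psd (M + N)"
  by (simp add: psd_def transpose_linear matrix_vector_mult_add_rdistrib inner_right_distrib)

lemma psd_scaleR: "psd M \<Longrightarrow> 0 \<le> c \<Longrightarrow> psd (c *\<^sub>R M)"
  by (simp add: psd_def transpose_linear scaleR_matrix_vector_assoc[symmetric])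

lemma convex_psd: "convex (Collect psd)"
  unfolding convex_def by (auto intro!: psd_add psd_scaleR)

lemma continuous_quad [continuous_intros]:
  fixes g h :: "_ \<Rightarrow> real^'n" and G :: "_ \<Rightarrow> real^'n^'n"
  assumes "continuous_on T g" "continuous_on T G" "continuous_on T h"
  shows "continuous_on T (\<lambda>x. g x \<bullet> (G x *v h x))"
  unfolding inner_vec_def matrix_vector_mult_def
  by (auto intro!: continuous_intros assms)

lemma closed_psd: "closed (Collect psd :: (real^'n^'n) set)"
proof -
  have e: "Collect psd = {M::real^'n^'n. transpose M = M} \<inter> (\<Inter>x. {M. 0 \<le> x \<bullet> (M *v x)})"
    by (auto simp: psd_def)
  have "continuous_on UNIV (\<lambda>M::real^'n^'n. transpose M)"
    unfolding transpose_def by (intro continuous_intros)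
  then have "closed {M::real^'n^'n. transpose M = M}"
    by (intro closed_Collect_eq continuous_intros)
  then show ?thesis unfolding e
    by (intro closed_Int closed_INT ballI closed_Collect_le continuous_intros)
qed

lemma psd_diag: "psd M \<Longrightarrow> 0 \<le> M $ i $ i"
  using psd_quad[of M "axis i 1"]
  by (simp add: matrix_vector_mul_component inner_axis' inner_axis)

text \<open>Minimising the form of \<open>M\<close> along x + s e_i leaves exactly the form of the
  deflated matrix at x, a Schur complement; \<open>s\<close> in the proof is the minimiser.\<close>

lemma psd_deflate:
  assumes "psd M" and pos: "0 < M $ i $ i"
  shows "psd (M - (1 / M $ i $ i) *\<^sub>R outer (M $ i) (M $ i))"
proof -
  let ?d = "M $ i $ i"
  have sym: "M $ a $ b = M $ b $ a" for a b
    using assms(1) unfolding psd_def by (metis transpose_def vec_lambda_beta)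
  have Me: "M *v axis i 1 = M $ i"
    by (simp add: vec_eq_iff matrix_vector_mul_component inner_axis sym)
  have "0 \<le> x \<bullet> ((M - (1 / ?d) *\<^sub>R outer (M $ i) (M $ i)) *v x)" for x
  proof -
    define s where "s = - (x \<bullet> M $ i) / ?d"
    have "0 \<le> (x + s *\<^sub>R axis i 1) \<bullet> (M *v (x + s *\<^sub>R axis i 1))"
      by (rule psd_quad[OF assms(1)])
    also have "\<dots> = x \<bullet> (M *v x) + 2 * s * (x \<bullet> M $ i) + s\<^sup>2 * ?d"
      using psd_symD[OF assms(1), of "axis i 1" x]
      by (simp add: matrix_vector_right_distrib matrix_vector_mult_scaleR inner_add_left
          inner_add_right Me inner_axis' power2_eq_square algebra_simps)
    also have "\<dots> = x \<bullet> (M *v x) - (x \<bullet> M $ i)\<^sup>2 / ?d"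
      using pos by (simp add: s_def field_simps power2_eq_square)
    finally show ?thesis
      by (simp add: matrix_vector_mult_diff_rdistrib scaleR_matrix_vector_assoc[symmetric]
          outer_mult_vec inner_diff_right inner_commute power2_eq_square)
  qed
  then show ?thesis using assms(1)
    by (auto simp: psd_def transpose_linear) (simp add: transpose_def outer_def vec_eq_iff mult.commute)
qed

text \<open>With a vanishing diagonal entry the form is affine in s along x + s e_i. For x equal to
  the row itself the slope is twice its squared norm, and an affine function bounded below has slope
  0.\<close>

lemma psd_zero_diag:
  assumes "psd M" "M $ i $ i = 0" shows "M $ i = 0"
proof -
  have sym: "M $ a $ b = M $ b $ a" for a b
    using assms(1) unfolding psd_def by (metis transpose_def vec_lambda_beta)
  have Me: "M *v axis i 1 = M $ i"
    by (simp add: vec_eq_iff matrix_vector_mul_component inner_axis sym)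
  let ?x = "M $ i"
  let ?q = "?x \<bullet> (M *v ?x)"
  have "0 \<le> (?x + s *\<^sub>R axis i 1) \<bullet> (M *v (?x + s *\<^sub>R axis i 1))" for s
    by (rule psd_quad[OF assms(1)])
  moreover have "(?x + s *\<^sub>R axis i 1) \<bullet> (M *v (?x + s *\<^sub>R axis i 1)) = ?q + 2 * s * (?x \<bullet> ?x)" for s
    using psd_symD[OF assms(1), of "axis i 1" ?x] assms(2)
    by (simp add: matrix_vector_right_distrib matrix_vector_mult_scaleR inner_add_left
        inner_add_right Me inner_axis' power2_eq_square algebra_simps)
  ultimately have *: "0 \<le> ?q + 2 * s * (?x \<bullet> ?x)" for s by metis
  show ?thesis
  proof (rule ccontr)
    assume "?x \<noteq> 0"
    then have "0 < ?x \<bullet> ?x" by simp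
    then have "2 * (- (?q + 1) / (?x \<bullet> ?x)) * (?x \<bullet> ?x) = - 2 * (?q + 1)" by simp
    then have "0 \<le> ?q + - 2 * (?q + 1)" using *[of "- (?q + 1) / (?x \<bullet> ?x)"] by metis
    then show False using psd_quad[OF assms(1), of ?x] by simp
  qed
qed

text \<open>Subtracting \<open>M $ i\<close> times its transpose over \<open>M $ i $ i\<close> clears row i, so a
  psd matrix is a sum of rank-one terms.\<close>

lemma psd_inner_nonneg:
  assumes "psd M" "psd N"
  shows "0 \<le> M \<bullet> N"
  using assms(1)
proof (induction "card {i. M $ i $ i \<noteq> 0}" arbitrary: M rule: less_induct)
  case less
  show ?case
  proof (cases "\<exists>i. M $ i $ i \<noteq> 0")
    case False
    then have "M = 0" using psd_zero_diag[OF less.prems] by (simp add: vec_eq_iff)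
    then show ?thesis by simp
  next
    case True
    then obtain i where i: "M $ i $ i \<noteq> 0" by blast
    then have pos: "0 < M $ i $ i" using psd_diag[OF less.prems, of i] by simp
    define M' where "M' = M - (1 / M $ i $ i) *\<^sub>R outer (M $ i) (M $ i)"
    have p: "psd M'" unfolding M'_def by (rule psd_deflate[OF less.prems pos])
    have sym: "M $ a $ b = M $ b $ a" for a b
      using less.prems unfolding psd_def by (metis transpose_def vec_lambda_beta)
    \<comment> \<open>Zero diagonal entries survive the deflation because the whole row a vanishes,
      and with it, by symmetry, the entry of row i that would be squared. So the number of nonzero
      diagonal entries drops, which drives the induction.\<close>
    have z: "M' $ a $ a = 0" if "M $ a $ a = 0" for a
      using psd_zero_diag[OF less.prems that] sym[of i a] that by (simp add: M'_def outer_def)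
    have "M' $ i $ i = 0" using i by (simp add: M'_def outer_def)
    then have "{a. M' $ a $ a \<noteq> 0} \<subset> {a. M $ a $ a \<noteq> 0}" using z i by auto
    then have "card {a. M' $ a $ a \<noteq> 0} < card {a. M $ a $ a \<noteq> 0}"
      by (intro psubset_card_mono) auto
    from less.hyps[OF this p] have "0 \<le> M' \<bullet> N" .
    moreover have "M' \<bullet> N = M \<bullet> N - (M $ i \<bullet> (N *v M $ i)) / M $ i $ i"
      by (simp add: M'_def inner_commute[of _ N] inner_diff_right inner_outer)
    ultimately show ?thesis using psd_quad[OF assms(2), of "M $ i"] pos
      by (smt (verit) divide_nonneg_pos)
  qed
qed

section \<open>Bordered matrices as homogenised quadratics\<close>

lemma sum_sum_type: "(\<Sum>i\<in>UNIV. g i) = (\<Sum>a\<in>UNIV. g (Inl a)) + (\<Sum>b\<in>UNIV. g (Inr b))"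
  for g :: "'a::finite + 'b::finite \<Rightarrow> 'c::comm_monoid_add"
  by (subst UNIV_Plus_UNIV[symmetric], subst sum.Plus) (auto simp: o_def)

lemma bordered_quad:
  fixes M :: "real^'n^'n" and y :: "real^('n + unit)"
  defines "x \<equiv> (\<chi> a. y $ Inl a)" and "s \<equiv> y $ Inr ()"
  shows "y \<bullet> (bordered M b c *v y) = x \<bullet> (M *v x) + 2 * s * (b \<bullet> x) + c * s\<^sup>2"
  by (simp add: x_def s_def inner_vec_def matrix_vector_mult_def bordered_def sum_sum_type
      UNIV_unit sum_distrib_left sum_distrib_right sum.distrib power2_eq_square algebra_simps)

lemma psd_borderedD:
  assumes "psd (bordered M b c)"
  shows "0 \<le> x \<bullet> (M *v x) + 2 * (b \<bullet> x) + c"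
  using psd_quad[OF assms, of "\<chi> i. case i of Inl a \<Rightarrow> x $ a | Inr _ \<Rightarrow> 1"]
  by (simp add: bordered_quad)

text \<open>Where the last coordinate s is nonzero, scaling by 1/s reduces the form to the
  quadratic. The hyperplane s = 0 is out of reach of scaling; there only the form of
  \<open>M\<close> remains, which is psd by assumption.\<close>

lemma psd_borderedI:
  assumes "psd M" and nn: "\<And>x. 0 \<le> x \<bullet> (M *v x) + 2 * (b \<bullet> x) + c"
  shows "psd (bordered M b c)"
proof -
  have sym: "M $ a $ b = M $ b $ a" for a b
    using assms(1) unfolding psd_def by (metis transpose_def vec_lambda_beta)
  have "0 \<le> x \<bullet> (M *v x) + 2 * s * (b \<bullet> x) + c * s\<^sup>2" for x s
  proof (cases "s = 0")
    case True then show ?thesis using psd_quad[OF assms(1)] by simp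
  next
    case False
    have "0 \<le> s\<^sup>2 * (((1/s) *\<^sub>R x) \<bullet> (M *v ((1/s) *\<^sub>R x)) + 2 * (b \<bullet> ((1/s) *\<^sub>R x)) + c)"
      by (intro mult_nonneg_nonneg nn) simp
    also have "\<dots> = x \<bullet> (M *v x) + 2 * s * (b \<bullet> x) + c * s\<^sup>2"
      using False by (simp add: matrix_vector_mult_scaleR field_simps power2_eq_square)
    finally show ?thesis .
  qed
  moreover have "transpose (bordered M b c) = bordered M b c"
    by (auto simp: transpose_def bordered_def vec_eq_iff sym split: sum.split)
  ultimately show ?thesis by (simp add: psd_def bordered_quad)
qed

section \<open>Farkas' lemma and convex quadratics on polyhedra\<close>

lemma convex_cone_hull_rangeD:
  fixes g :: "'i::finite \<Rightarrow> 'a::real_vector"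
  assumes "x \<in> convex_cone hull (range g)"
  obtains c where "\<And>i. 0 \<le> c i" "x = (\<Sum>i\<in>UNIV. c i *\<^sub>R g i)"
proof -
  let ?C = "{x. \<exists>c. (\<forall>i. 0 \<le> c i) \<and> x = (\<Sum>i\<in>UNIV. c i *\<^sub>R g i)}"
  have "convex_cone ?C"
    unfolding convex_cone_iff
  proof (intro conjI ballI allI impI)
    show "0 \<in> ?C" by (auto intro!: exI[of _ "\<lambda>_. 0"])
  next
    fix x y assume "x \<in> ?C" "y \<in> ?C"
    then obtain c d where "\<forall>i. 0 \<le> c i" "x = (\<Sum>i\<in>UNIV. c i *\<^sub>R g i)"
      "\<forall>i. 0 \<le> d i" "y = (\<Sum>i\<in>UNIV. d i *\<^sub>R g i)" by auto
    then show "x + y \<in> ?C"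
      by (auto intro!: exI[of _ "\<lambda>i. c i + d i"] simp: scaleR_add_left sum.distrib)
  next
    fix x and r :: real assume "x \<in> ?C" "0 \<le> r"
    then obtain c where "\<forall>i. 0 \<le> c i" "x = (\<Sum>i\<in>UNIV. c i *\<^sub>R g i)" by auto
    with \<open>0 \<le> r\<close> show "r *\<^sub>R x \<in> ?C"
      by (auto intro!: exI[of _ "\<lambda>i. r * c i"] simp: scaleR_sum_right)
  qed
  moreover have "range g \<subseteq> ?C"
  proof clarify
    fix i show "\<exists>c. (\<forall>j. 0 \<le> c j) \<and> g i = (\<Sum>j\<in>UNIV. c j *\<^sub>R g j)"
      by (auto intro!: exI[of _ "\<lambda>j. if j = i then 1 else 0"] simp: if_distrib[of "\<lambda>t. t *\<^sub>R _"] cong: if_cong)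
  qed
  ultimately have "convex_cone hull (range g) \<subseteq> ?C" by (simp add: hull_minimal)
  then show thesis using assms that by blast
qed

lemma transpose_mult_vec_inner: "(transpose E *v p) \<bullet> y = p \<bullet> (E *v y)"
  for E :: "real^'n^'q"
  by (simp add: dot_lmul_matrix)

text \<open>The rows (E_i, f_i) together with (0, 1) span a closed cone; the extra generator absorbs
  the slack in f . p \<le> d. If (c, d) were outside, a separating vector (y, s) would yield a
  feasible point, or a feasible ray, that violates the bound.\<close>

lemma affine_farkas:
  fixes E :: "real^'n^'q"
  assumes ne: "polyhedron_of E f \<noteq> {}"
    and le: "\<And>y. y \<in> polyhedron_of E f \<Longrightarrow> c \<bullet> y \<le> d"
  obtains p where "0 \<le> p" "transpose E *v p = c" "f \<bullet> p \<le> d"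
proof -
  define g :: "'q + unit \<Rightarrow> (real^'n) \<times> real"
    where "g = (\<lambda>r. case r of Inl i \<Rightarrow> (E $ i, f $ i) | Inr _ \<Rightarrow> (0, 1))"
  let ?C = "convex_cone hull (range g)"
  have gC: "g r \<in> ?C" for r by (rule hull_inc) simp
  have "(c, d) \<in> ?C"
  proof (rule ccontr)
    assume "(c, d) \<notin> ?C"
    moreover have "closed ?C" by (rule closed_convex_cone_hull) simp
    ultimately obtain v b where v: "v \<bullet> (c, d) < b" "\<forall>x\<in>?C. b < v \<bullet> x"
      using separating_hyperplane_closed_point[OF convex_convex_cone_hull] by blast
    obtain y s where vy: "v = (y, s)" by (cases v)
    have b: "b < 0" using v(2) convex_cone_hull_contains_0 by fastforce
    have nn: "0 \<le> v \<bullet> x" if "x \<in> ?C" for x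
    proof (rule ccontr)
      assume "\<not> 0 \<le> v \<bullet> x"
      then have neg: "v \<bullet> x < 0" by simp
      have "(b / (v \<bullet> x)) *\<^sub>R x \<in> ?C"
        using b neg that by (intro convex_cone_hull_mul) (auto simp: divide_nonpos_neg)
      then have "b < v \<bullet> ((b / (v \<bullet> x)) *\<^sub>R x)" using v(2) by blast
      then show False using neg by simp
    qed
    have s: "0 \<le> s" using nn[OF gC[of "Inr ()"]] by (simp add: g_def vy inner_Pair)
    have r: "0 \<le> y \<bullet> E $ i + s * f $ i" for i
      using nn[OF gC[of "Inl i"]] by (simp add: g_def vy inner_Pair)
    have cd: "y \<bullet> c + s * d < 0" using v(1) b by (simp add: vy inner_Pair)
    show False
    proof (cases "s = 0")
      case False
      with s have s: "0 < s" by simp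
      \<comment> \<open>Dehomogenising the separating vector gives a feasible point at which c
        exceeds d.\<close>
      have "- (1/s) *\<^sub>R y \<in> polyhedron_of E f"
      proof -
        have "E $ i \<bullet> (- (1/s) *\<^sub>R y) \<le> f $ i" for i
          using r[of i] s by (simp add: field_simps inner_commute)
        then show ?thesis
          by (simp add: polyhedron_of_def less_eq_vec_def matrix_vector_mul_component)
      qed
      from le[OF this] show False using cd s by (simp add: field_simps inner_commute)
    next
      case True
      obtain y0 where y0: "y0 \<in> polyhedron_of E f" using ne by blast
      have neg: "y \<bullet> c < 0" using cd True by simp
      \<comment> \<open>For s = 0 the direction -y is a recession direction along which c grows;
        \<open>t\<close> is the length after which the value surpasses d, whatever the start
        \<open>y0\<close>.\<close>
      define t where "t = (\<bar>d - c \<bullet> y0\<bar> + 1) / (- (y \<bullet> c))"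
      have t: "0 \<le> t" using neg by (simp add: t_def divide_nonneg_neg)
      have "y0 - t *\<^sub>R y \<in> polyhedron_of E f"
      proof -
        have "E $ i \<bullet> (y0 - t *\<^sub>R y) \<le> f $ i" for i
        proof -
          have "E $ i \<bullet> y0 \<le> f $ i" using y0
            by (simp add: polyhedron_of_def less_eq_vec_def matrix_vector_mul_component)
          moreover have "0 \<le> t * (E $ i \<bullet> y)" using r[of i] True t by (simp add: inner_commute)
          ultimately show ?thesis by (simp add: inner_diff_right)
        qed
        then show ?thesis
          by (simp add: polyhedron_of_def less_eq_vec_def matrix_vector_mul_component)
      qed
      from le[OF this] have "c \<bullet> y0 - t * (y \<bullet> c) \<le> d" by (simp add: inner_diff_right inner_commute)
      moreover have "t * (y \<bullet> c) = - (\<bar>d - c \<bullet> y0\<bar> + 1)" using neg by (simp add: t_def)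
      ultimately show False by linarith
    qed
  qed
  then obtain w where w: "\<And>i. 0 \<le> w i" "(c, d) = (\<Sum>i\<in>UNIV. w i *\<^sub>R g i)"
    by (elim convex_cone_hull_rangeD) blast
  define p :: "real^'q" where "p = (\<chi> i. w (Inl i))"
  have "(c, d) = (\<Sum>i\<in>UNIV. p $ i *\<^sub>R (E $ i, f $ i)) + w (Inr ()) *\<^sub>R (0, 1)"
    using w(2) by (simp add: sum_sum_type g_def UNIV_unit p_def)
  then have "c = (\<Sum>i\<in>UNIV. p $ i *\<^sub>R E $ i)" "d = (\<Sum>i\<in>UNIV. p $ i * f $ i) + w (Inr ())"
    by (simp_all add: prod_eq_iff fst_sum snd_sum)
  show thesis
  proof (rule that[of p])
    show "0 \<le> p" by (simp add: p_def less_eq_vec_def w(1))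
    show "transpose E *v p = c" unfolding \<open>c = _\<close>
      by (simp add: vec_eq_iff matrix_vector_mult_def transpose_def mult.commute)
    show "f \<bullet> p \<le> d" unfolding \<open>d = _\<close>
      using w(1)[of "Inr ()"] by (simp add: inner_vec_def mult.commute)
  qed
qed

section \<open>Certificates for convex quadratics on polyhedra\<close>

lemma convex_polyhedron_of: "convex (polyhedron_of E f)"
proof -
  have e: "polyhedron_of E f = (\<Inter>i. {y. E $ i \<bullet> y \<le> f $ i})"
    by (auto simp: polyhedron_of_def less_eq_vec_def matrix_vector_mul_component)
  show ?thesis unfolding e by (intro convex_INT convex_halfspace_le)
qed

lemma closed_polyhedron_of: "closed (polyhedron_of E f)"
proof -
  have e: "polyhedron_of E f = (\<Inter>i. {y. E $ i \<bullet> y \<le> f $ i})"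
    by (auto simp: polyhedron_of_def less_eq_vec_def matrix_vector_mul_component)
  show ?thesis unfolding e by (intro closed_INT ballI closed_halfspace_le)
qed

text \<open>At a minimiser \<open>y0\<close> the gradient of the quadratic is nonnegative in every feasible direction,
  so Farkas' lemma yields multipliers for it; the bordered form then equals
  the quadratic form of \<open>M\<close> at \<open>x - y0\<close> plus nonnegative terms.\<close>

lemma convex_quadratic_multiplier:
  fixes E :: "real^'n^'q"
  assumes ne: "polyhedron_of E f \<noteq> {}" and bdd: "bounded (polyhedron_of E f)"
    and M: "psd M"
    and nn: "\<And>y. y \<in> polyhedron_of E f \<Longrightarrow> 0 \<le> y \<bullet> (M *v y) + b \<bullet> y + t"
  obtains p where "0 \<le> p" "psd (bordered M ((1/2) *\<^sub>R (b + transpose E *v p)) (t - f \<bullet> p))"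
proof -
  let ?W = "polyhedron_of E f"
  let ?q = "\<lambda>y. y \<bullet> (M *v y) + b \<bullet> y + t"
  have "compact ?W" using bdd closed_polyhedron_of compact_eq_bounded_closed by blast
  moreover have "continuous_on ?W ?q" by (intro continuous_intros)
  ultimately obtain y0 where y0: "y0 \<in> ?W" "\<And>y. y \<in> ?W \<Longrightarrow> ?q y0 \<le> ?q y"
    using continuous_attains_inf[OF _ ne] by blast
  let ?g = "2 *\<^sub>R (M *v y0) + b"
  have expand: "?q (y0 + s *\<^sub>R v) = ?q y0 + s * (?g \<bullet> v) + s\<^sup>2 * (v \<bullet> (M *v v))" for s v
    using psd_symD[OF M, of y0 v]
    by (simp add: matrix_vector_right_distrib matrix_vector_mult_scaleR inner_add_left
        inner_add_right power2_eq_square inner_commute[of "M *v y0"] algebra_simps)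
  have "- ?g \<bullet> y \<le> - ?g \<bullet> y0" if y: "y \<in> ?W" for y
  proof (rule ccontr)
    assume "\<not> - ?g \<bullet> y \<le> - ?g \<bullet> y0"
    then have neg: "?g \<bullet> (y - y0) < 0" by (simp add: inner_diff_right inner_diff_left inner_add_left)
    let ?v = "y - y0"
    let ?k = "?v \<bullet> (M *v ?v)"
    have k: "0 \<le> ?k" by (rule psd_quad[OF M])
    \<comment> \<open>The cap 1 keeps the point on the segment from \<open>y0\<close> to
      \<open>y\<close>, hence in the polyhedron; the other bound lets the second-order term use up
      at most half of the descent.\<close>
    define s where "s = min 1 (- (?g \<bullet> ?v) / (2 * (?k + 1)))"
    have s: "0 < s" "s \<le> 1" using neg k by (simp_all add: s_def divide_neg_pos)
    have "s \<le> - (?g \<bullet> ?v) / (2 * (?k + 1))" by (simp add: s_def)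
    moreover have "0 < 2 * (?k + 1)" using k by simp
    ultimately have "s * (2 * (?k + 1)) \<le> - (?g \<bullet> ?v)" by (metis pos_le_divide_eq)
    then have "2 * (s * ?k) + 2 * s \<le> - (?g \<bullet> ?v)" by (simp add: algebra_simps)
    moreover have "0 \<le> s * ?k" using s k by simp
    ultimately have "?g \<bullet> ?v + s * ?k < 0" using s neg by linarith
    then have "s * (?g \<bullet> ?v + s * ?k) < 0" using s(1) by (simp add: mult_pos_neg)
    then have "?q (y0 + s *\<^sub>R ?v) < ?q y0" by (simp add: expand power2_eq_square distrib_left)
    moreover have "y0 + s *\<^sub>R ?v \<in> ?W"
    proof -
      have "(1 - s) *\<^sub>R y0 + s *\<^sub>R y \<in> ?W"
        using convex_polyhedron_of[of E f] y y0(1) s by (auto simp: convex_def)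
      then show ?thesis by (simp add: algebra_simps)
    qed
    ultimately show False using y0(2) by fastforce
  qed
  then obtain p where p: "0 \<le> p" "transpose E *v p = - ?g" "f \<bullet> p \<le> - ?g \<bullet> y0"
    using affine_farkas[OF ne] by metis
  have "0 \<le> x \<bullet> (M *v x) + 2 * (((1/2) *\<^sub>R (b + transpose E *v p)) \<bullet> x) + (t - f \<bullet> p)" for x
  proof -
    have "0 \<le> (x - y0) \<bullet> (M *v (x - y0)) + ?q y0"
      using psd_quad[OF M] nn[OF y0(1)] by (simp add: add_nonneg_nonneg)
    also have "\<dots> = x \<bullet> (M *v x) - 2 * ((M *v y0) \<bullet> x) + t - (- ?g \<bullet> y0)"
      using psd_symD[OF M, of y0 x]
      by (simp add: matrix_vector_mult_diff_distrib inner_diff_left inner_diff_right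
          inner_add_left inner_commute[of "M *v y0"] algebra_simps)
    also have "\<dots> \<le> x \<bullet> (M *v x) - 2 * ((M *v y0) \<bullet> x) + t - f \<bullet> p"
      using p(3) by simp
    also have "\<dots> = x \<bullet> (M *v x) + 2 * (((1/2) *\<^sub>R (b + transpose E *v p)) \<bullet> x) + (t - f \<bullet> p)"
      unfolding p(2) by simp
    finally show ?thesis .
  qed
  then have "psd (bordered M ((1/2) *\<^sub>R (b + transpose E *v p)) (t - f \<bullet> p))"
    by (rule psd_borderedI[OF M])
  with p(1) show thesis by (rule that)
qed

text \<open>The bordered form at (y, 1) is the quadratic minus p . (f - E y), and the subtracted
  term is nonnegative on the polyhedron.\<close>

lemma polyhedron_quadratic_nonneg:
  fixes E :: "real^'n^'q"
  assumes "psd (bordered M ((1/2) *\<^sub>R (b + transpose E *v p)) (t - f \<bullet> p))" "0 \<le> p"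
    and y: "y \<in> polyhedron_of E f"
  shows "0 \<le> y \<bullet> (M *v y) + b \<bullet> y + t"
proof -
  have "p \<bullet> (E *v y) \<le> p \<bullet> f"
    using assms(2) y unfolding inner_vec_def polyhedron_of_def less_eq_vec_def
    by (intro sum_mono) (auto intro: mult_left_mono)
  moreover have "0 \<le> y \<bullet> (M *v y) + (b \<bullet> y + p \<bullet> (E *v y)) + (t - f \<bullet> p)"
    using psd_borderedD[OF assms(1), of y] by (simp add: inner_add_left dot_lmul_matrix add_divide_distrib)
  ultimately show ?thesis by (simp add: inner_commute[of f])
qed

section \<open>Finitely supported measures\<close>

text \<open>Meant for weight functions \<open>p\<close> of finite support; for infinite support the value is 0.\<close>

definition expect :: "('a \<Rightarrow> real) \<Rightarrow> ('a \<Rightarrow> 'b::real_vector) \<Rightarrow> 'b" where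
  "expect p g = (\<Sum>x | p x \<noteq> 0. p x *\<^sub>R g x)"

definition fin_prob :: "'a set \<Rightarrow> ('a \<Rightarrow> real) set" where
  "fin_prob W = {p. finite {x. p x \<noteq> 0} \<and> (\<forall>x. 0 \<le> p x) \<and> {x. p x \<noteq> 0} \<subseteq> W \<and>
     expect p (\<lambda>_. 1::real) = 1}"

text \<open>A point measure lives on the power set of its support; pushing it forward along the
  identity gives it the Borel sets of the whole space, as \<open>component_set\<close>
  demands.\<close>

definition fin_measure :: "('a::topological_space \<Rightarrow> real) \<Rightarrow> 'a measure" where
  "fin_measure p = distr (point_measure {x. p x \<noteq> 0} (\<lambda>x. ennreal (p x))) borel id"

lemma expect_superset:
  assumes "finite F" "{x. p x \<noteq> 0} \<subseteq> F"
  shows "expect p g = (\<Sum>x\<in>F. p x *\<^sub>R g x)"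
  unfolding expect_def using assms by (intro sum.mono_neutral_left) auto

lemma support_sum_subset:
  fixes p :: "'j \<Rightarrow> 'a \<Rightarrow> real"
  shows "{x. (\<Sum>j\<in>J. c j * p j x) \<noteq> 0} \<subseteq> (\<Union>j\<in>J. {x. p j x \<noteq> 0})"
proof
  fix x assume "x \<in> {x. (\<Sum>j\<in>J. c j * p j x) \<noteq> 0}"
  then have "\<exists>j\<in>J. c j * p j x \<noteq> 0" using sum.neutral[of J "\<lambda>j. c j * p j x"] by blast
  then show "x \<in> (\<Union>j\<in>J. {x. p j x \<noteq> 0})" by auto
qed

lemma expect_sum:
  assumes "finite J" "\<And>j. j \<in> J \<Longrightarrow> finite {x. p j x \<noteq> 0}"
  shows "expect (\<lambda>x. \<Sum>j\<in>J. c j * p j x) g = (\<Sum>j\<in>J. c j *\<^sub>R expect (p j) g)"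
proof -
  let ?F = "\<Union>j\<in>J. {x. p j x \<noteq> 0}"
  have F: "finite ?F" using assms by blast
  have "{x. (\<Sum>j\<in>J. c j * p j x) \<noteq> 0} \<subseteq> ?F"
    by (rule support_sum_subset)
  then have "expect (\<lambda>x. \<Sum>j\<in>J. c j * p j x) g = (\<Sum>x\<in>?F. (\<Sum>j\<in>J. c j * p j x) *\<^sub>R g x)"
    by (rule expect_superset[OF F])
  also have "\<dots> = (\<Sum>j\<in>J. c j *\<^sub>R (\<Sum>x\<in>?F. p j x *\<^sub>R g x))"
    unfolding scaleR_sum_left scaleR_sum_right by (subst sum.swap) simp
  also have "\<dots> = (\<Sum>j\<in>J. c j *\<^sub>R expect (p j) g)"
    by (intro sum.cong refl arg_cong[of _ _ "(*\<^sub>R) _"] expect_superset[symmetric] F) auto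
  finally show ?thesis .
qed

lemma expect_lincomb:
  assumes "finite {x. p x \<noteq> 0}" "finite {x. q x \<noteq> 0}"
  shows "expect (\<lambda>x. a * p x + b * q x) g = a *\<^sub>R expect p g + b *\<^sub>R expect q g"
proof -
  let ?F = "{x. p x \<noteq> 0} \<union> {x. q x \<noteq> 0}"
  have F: "finite ?F" using assms by blast
  have "expect (\<lambda>x. a * p x + b * q x) g = (\<Sum>x\<in>?F. (a * p x + b * q x) *\<^sub>R g x)"
    "expect p g = (\<Sum>x\<in>?F. p x *\<^sub>R g x)" "expect q g = (\<Sum>x\<in>?F. q x *\<^sub>R g x)"
    by (rule expect_superset[OF F]; auto)+
  then show ?thesis by (simp add: scaleR_sum_right scaleR_add_left sum.distrib)
qed

lemma expect_point: "expect (\<lambda>x. if x = y then 1 else 0) g = g y"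
  by (simp add: expect_def if_distrib[of "\<lambda>t. t = _"] cong: if_cong)

lemma expect_mono:
  fixes g h :: "'a \<Rightarrow> real"
  assumes "p \<in> fin_prob W" "\<And>x. x \<in> W \<Longrightarrow> g x \<le> h x"
  shows "expect p g \<le> expect p h"
  unfolding expect_def using assms by (intro sum_mono) (auto simp: fin_prob_def intro!: mult_left_mono)

lemma expect_linear:
  "expect p (\<lambda>x. g x + h x) = expect p g + expect p h"
  "expect p (\<lambda>x. c *\<^sub>R g x) = c *\<^sub>R expect p g"
  by (simp_all add: expect_def scaleR_add_right sum.distrib scaleR_sum_right mult.commute)

lemma expect_const: "p \<in> fin_prob W \<Longrightarrow> expect p (\<lambda>_. c::real) = c"
  by (simp add: fin_prob_def expect_def sum_distrib_right[symmetric])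

lemma fin_prob_point: "y \<in> W \<Longrightarrow> (\<lambda>x. if x = y then 1 else 0) \<in> fin_prob W"
  by (simp add: fin_prob_def expect_point)

lemma fin_prob_mix:
  assumes "p \<in> fin_prob W" "q \<in> fin_prob W" "0 \<le> a" "0 \<le> b" "a + b = 1"
  shows "(\<lambda>x. a * p x + b * q x) \<in> fin_prob W"
proof -
  have fin: "finite {x. p x \<noteq> 0}" "finite {x. q x \<noteq> 0}" using assms by (auto simp: fin_prob_def)
  have sub: "{x. a * p x + b * q x \<noteq> 0} \<subseteq> {x. p x \<noteq> 0} \<union> {x. q x \<noteq> 0}" by auto
  show ?thesis using assms finite_subset[OF sub] fin sub
    by (auto simp: fin_prob_def expect_lincomb)
qed

lemma sets_fin_measure [simp, measurable_cong]: "sets (fin_measure p) = sets borel"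
  by (simp add: fin_measure_def)

lemma nn_integral_fin_measure:
  assumes "finite {x. p x \<noteq> 0}" "\<And>x. 0 \<le> p x" "g \<in> borel_measurable borel" "\<And>x. 0 \<le> g x"
  shows "(\<integral>\<^sup>+x. ennreal (g x) \<partial>fin_measure p) = ennreal (expect p g)"
  using assms
  by (simp add: fin_measure_def nn_integral_distr nn_integral_point_measure_finite expect_def
      ennreal_mult[symmetric] sum_ennreal)

lemma emeasure_fin_measure:
  assumes "finite {x. p x \<noteq> 0}" "\<And>x. 0 \<le> p x" "X \<in> sets borel"
  shows "emeasure (fin_measure p) X = ennreal (expect p (indicator X))"
proof -
  have "emeasure (fin_measure p) X = (\<integral>\<^sup>+x. ennreal (indicator X x) \<partial>fin_measure p)"
    using assms(3) by (subst nn_integral_indicator[symmetric]) (auto simp: ennreal_indicator)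
  also have "\<dots> = ennreal (expect p (indicator X))"
    using assms by (intro nn_integral_fin_measure) auto
  finally show ?thesis .
qed

lemma integral_fin_measure:
  fixes g :: "'a::topological_space \<Rightarrow> 'b::{banach, second_countable_topology}"
  assumes "finite {x. p x \<noteq> 0}" "\<And>x. 0 \<le> p x" "g \<in> borel_measurable borel"
  shows "integral\<^sup>L (fin_measure p) g = expect p g"
  using assms
  by (simp add: fin_measure_def integral_distr lebesgue_integral_point_measure_finite expect_def)

section \<open>Finitely supported members of the ambiguity set\<close>

definition fin_component :: "(real^'n) set \<Rightarrow> real^'n \<Rightarrow> real^'n^'n \<Rightarrow> (real^'n \<Rightarrow> real) set" where
  "fin_component W \<mu> S = {p \<in> fin_prob W. expect p (\<lambda>x. x) = \<mu> \<and>
     loewner_le (expect p (\<lambda>x. outer x x)) (S + outer \<mu> \<mu>)}"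

text \<open>The mean is prescribed, so \<open>S + outer \<mu> \<mu>\<close> is the same matrix for
  both weight functions and the Loewner condition is affine in the weights.\<close>

lemma fin_component_mix:
  assumes "p \<in> fin_component W \<mu> S" "q \<in> fin_component W \<mu> S" "0 \<le> a" "0 \<le> b" "a + b = 1"
  shows "(\<lambda>x. a * p x + b * q x) \<in> fin_component W \<mu> S"
proof -
  have fin: "finite {x. p x \<noteq> 0}" "finite {x. q x \<noteq> 0}"
    using assms by (auto simp: fin_component_def fin_prob_def)
  let ?R = "S + outer \<mu> \<mu>"
  let ?e = "\<lambda>p. expect p (\<lambda>x. outer x x)"
  have "psd (a *\<^sub>R (?R - ?e p) + b *\<^sub>R (?R - ?e q))"
    using assms by (intro psd_add psd_scaleR) (auto simp: fin_component_def loewner_le_def)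
  also have "a *\<^sub>R (?R - ?e p) + b *\<^sub>R (?R - ?e q) = (a + b) *\<^sub>R ?R - (a *\<^sub>R ?e p + b *\<^sub>R ?e q)"
    by (simp add: algebra_simps)
  finally have "psd (?R - (a *\<^sub>R ?e p + b *\<^sub>R ?e q))" using assms by simp
  moreover have "a *\<^sub>R \<mu> + b *\<^sub>R \<mu> = \<mu>"
    using assms(5) by (metis scaleR_add_left scaleR_one)
  ultimately show ?thesis using assms
    by (simp add: fin_component_def fin_prob_mix expect_lincomb[OF fin] loewner_le_def)
qed

lemma continuous_outer: "continuous_on T (\<lambda>x. outer x x)"
  unfolding outer_def by (intro continuous_intros)

lemma outer_measurable [measurable]: "(\<lambda>x::real^'n. outer x x) \<in> borel_measurable borel"
  by (intro borel_measurable_continuous_onI continuous_outer)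

lemma fin_component_measure:
  fixes W :: "(real^'n) set"
  assumes W: "W \<in> sets borel" and p: "p \<in> fin_component W \<mu> S"
  shows "fin_measure p \<in> component_set W \<mu> S"
proof -
  have fp: "finite {x. p x \<noteq> 0}" "\<And>x. 0 \<le> p x" "{x. p x \<noteq> 0} \<subseteq> W" "expect p (\<lambda>_. 1::real) = 1"
    using p by (auto simp: fin_component_def fin_prob_def)
  have ind: "expect p (\<lambda>x. indicator W x *\<^sub>R g x) = expect p g" for g :: "real^'n \<Rightarrow> 'b::real_vector"
    unfolding expect_def using fp(3) by (intro sum.cong) auto
  have "(LINT x:W|fin_measure p. x) = \<mu>"
    unfolding set_lebesgue_integral_def using p W
    by (subst integral_fin_measure[OF fp(1,2)]) (auto simp: ind fin_component_def)
  moreover have "(LINT x:W|fin_measure p. outer x x) = expect p (\<lambda>x. outer x x)"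
    unfolding set_lebesgue_integral_def using W
    by (subst integral_fin_measure[OF fp(1,2)]) (auto simp: ind)
  moreover have "emeasure (fin_measure p) W = 1"
    using ind[of "\<lambda>_. 1::real"] fp(4)
    by (simp add: emeasure_fin_measure[OF fp(1,2) W])
  moreover have "expect p (indicator (- W) :: _ \<Rightarrow> real) = expect p (\<lambda>x. 0 *\<^sub>R 1)"
    unfolding expect_def using fp(3) by (intro sum.cong) auto
  then have "emeasure (fin_measure p) (- W) = 0" using W
    by (simp add: emeasure_fin_measure[OF fp(1,2)] expect_linear expect_def)
  ultimately show ?thesis using p by (auto simp: component_set_def fin_component_def)
qed

lemma fin_ambiguity:
  assumes W: "W \<in> sets borel" and p: "\<And>j. j < m \<Longrightarrow> p j \<in> fin_component W (\<mu> j) (S j)"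
    and \<gamma>: "\<And>j. j < m \<Longrightarrow> 0 \<le> \<gamma> j"
  shows "fin_measure (\<lambda>x. \<Sum>j<m. \<gamma> j * p j x) \<in> ambiguity_set W m \<gamma> \<mu> S"
proof -
  have fp: "finite {x. p j x \<noteq> 0}" "0 \<le> p j x" if "j < m" for j x
    using p[OF that] by (auto simp: fin_component_def fin_prob_def)
  have "finite (\<Union>j<m. {x. p j x \<noteq> 0})" using fp by auto
  moreover have "{x. (\<Sum>j<m. \<gamma> j * p j x) \<noteq> 0} \<subseteq> (\<Union>j<m. {x. p j x \<noteq> 0})"
    by (rule support_sum_subset)
  ultimately have fin: "finite {x. (\<Sum>j<m. \<gamma> j * p j x) \<noteq> 0}" by (rule finite_subset[rotated])
  have nn: "0 \<le> (\<Sum>j<m. \<gamma> j * p j x)" for x using fp \<gamma> by (intro sum_nonneg) auto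
  have ennn: "0 \<le> expect (p j) (indicator X :: _ \<Rightarrow> real)" if "j < m" for j X
    unfolding expect_def using fp[OF that] by (intro sum_nonneg) auto
  have "emeasure (fin_measure (\<lambda>x. \<Sum>j<m. \<gamma> j * p j x)) X = (\<Sum>j<m. ennreal (\<gamma> j) * emeasure (fin_measure (p j)) X)"
    if "X \<in> sets borel" for X
  proof -
    have "expect (\<lambda>x. \<Sum>j<m. \<gamma> j * p j x) (indicator X) = (\<Sum>j<m. \<gamma> j *\<^sub>R expect (p j) (indicator X :: _ \<Rightarrow> real))"
      using fp by (intro expect_sum) auto
    moreover have "0 \<le> \<gamma> j * expect (p j) (indicator X)" if "j < m" for j
      using \<gamma> ennn that by simp
    ultimately show ?thesis using that fp \<gamma> ennn
      by (simp add: emeasure_fin_measure[OF fin nn] emeasure_fin_measure ennreal_mult[symmetric])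
        (rule sum_ennreal[symmetric], auto)
  qed
  then show ?thesis using fin_component_measure[OF W p]
    unfolding ambiguity_set_def by (auto intro!: exI[of _ "\<lambda>j. fin_measure (p j)"])
qed

section \<open>Duality of moments and minimax\<close>

text \<open>Reads off the sign of a coefficient of a separating functional: the separated set
  contains a ray, along which the functional stays bounded on one side.\<close>

lemma nonpos_of_bounded_multiples:
  fixes x :: real
  assumes "\<And>c. 0 \<le> c \<Longrightarrow> c * x \<le> D"
  shows "x \<le> 0"
proof (rule ccontr)
  assume "\<not> x \<le> 0"
  then have "(\<bar>D\<bar> + 1) / x * x = \<bar>D\<bar> + 1" "0 \<le> (\<bar>D\<bar> + 1) / x" by auto
  then show False using assms[of "(\<bar>D\<bar> + 1) / x"] by linarith
qed

lemma inner_transpose: "transpose A \<bullet> B = A \<bullet> transpose B" for A :: "real^'n^'m"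
  by (simp add: inner_vec_def transpose_def) (rule sum.swap)

lemma psd_transpose: "psd M \<Longrightarrow> transpose M = M"
  by (simp add: psd_def)

text \<open>The hull of the lifted points is compact, and the admissible moments paired with values
  at least \<open>F + \<delta>\<close> form a closed convex set, so the positive gap
  \<open>\<delta>\<close> allows strict separation. Dividing the functional by its last coefficient
  \<open>k\<close> turns its first two parts into \<omega> and \<Omega>, and the separating level
  into t.\<close>

lemma moment_duality:
  fixes W :: "(real^'n) set" and g :: "real^'n \<Rightarrow> real"
  assumes W: "compact W" and \<mu>: "\<mu> \<in> W" and S: "psd S" and g: "continuous_on W g"
    and ub: "\<And>p. p \<in> fin_component W \<mu> S \<Longrightarrow> expect p g \<le> F" and \<delta>: "0 < \<delta>"
  obtains t \<omega> \<Omega> where "psd \<Omega>" "\<And>\<xi>. \<xi> \<in> W \<Longrightarrow> g \<xi> \<le> \<xi> \<bullet> (\<Omega> *v \<xi>) + \<omega> \<bullet> \<xi> + t"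
    "t + \<mu> \<bullet> \<omega> + (S + outer \<mu> \<mu>) \<bullet> \<Omega> \<le> F + \<delta>"
proof -
  let ?R = "S + outer \<mu> \<mu>"
  define f where "f = (\<lambda>\<xi>. (\<xi>, outer \<xi> \<xi>, g \<xi>))"
  let ?C = "convex hull (f ` W)"
  let ?T = "{\<mu>} \<times> {Q. psd (?R - Q)} \<times> {F + \<delta>..}"
  let ?D = "{(expect p (\<lambda>x. x), expect p (\<lambda>x. outer x x), expect p g) | p. p \<in> fin_prob W}"
  have "continuous_on W f" unfolding f_def by (intro continuous_intros continuous_outer g)
  then have C: "compact ?C" by (intro compact_convex_hull compact_continuous_image W)
  have "?C \<subseteq> ?D"
  proof (rule hull_minimal)
    show "f ` W \<subseteq> ?D"
    proof
      fix y assume "y \<in> f ` W"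
      then obtain \<xi> where "\<xi> \<in> W" "y = f \<xi>" by blast
      with fin_prob_point[of \<xi> W] show "y \<in> ?D"
        by (auto intro!: exI[of _ "\<lambda>x. if x = \<xi> then 1 else 0"] simp: f_def expect_point)
    qed
    show "convex ?D"
      unfolding convex_def
    proof clarsimp
      fix p q and u v :: real
      assume pq: "p \<in> fin_prob W" "q \<in> fin_prob W" and uv: "0 \<le> u" "0 \<le> v" "u + v = 1"
      then have "finite {x. p x \<noteq> 0}" "finite {x. q x \<noteq> 0}" by (auto simp: fin_prob_def)
      then show "\<exists>r. u *\<^sub>R expect p (\<lambda>x. x) + v *\<^sub>R expect q (\<lambda>x. x) = expect r (\<lambda>x. x) \<and>
        u *\<^sub>R expect p (\<lambda>x. outer x x) + v *\<^sub>R expect q (\<lambda>x. outer x x) = expect r (\<lambda>x. outer x x) \<and>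
        u * expect p g + v * expect q g = expect r g \<and> r \<in> fin_prob W"
        using fin_prob_mix[OF pq uv]
        by (intro exI[of _ "\<lambda>x. u * p x + v * q x"]) (simp add: expect_lincomb)
    qed
  qed
  \<comment> \<open>A common point would be the moment vector of a finitely supported admissible law
    under which \<open>g\<close> has expectation at least \<open>F + \<delta>\<close>, against
    \<open>ub\<close>.\<close>
  then have disj: "?C \<inter> ?T = {}"
    using ub \<delta> by (fastforce simp: fin_component_def loewner_le_def)
  have psdT: "{Q. psd (?R - Q)} = (\<lambda>M. ?R - M) ` Collect psd"
    by (auto simp: image_iff intro!: exI[of _ "?R - _"])
  have "closed ((\<lambda>M. ?R - M) ` Collect psd)"
    using closed_translation[OF closed_negations[OF closed_psd], of ?R] by (simp add: image_image)
  moreover have "convex ((\<lambda>M. ?R - M) ` Collect psd)"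
    using convex_translation[OF convex_negations[OF convex_psd], of ?R] by (simp add: image_image)
  ultimately have "closed ?T" "convex ?T"
    unfolding psdT by (auto intro!: closed_Times convex_Times)
  moreover have "?C \<noteq> {}" using \<mu> by auto
  ultimately obtain v b where v: "\<And>x. x \<in> ?C \<Longrightarrow> v \<bullet> x < b" "\<And>x. x \<in> ?T \<Longrightarrow> b < v \<bullet> x"
    using separating_hyperplane_compact_closed[OF convex_convex_hull C _ _ _ disj] by blast
  obtain w Q k where vw: "v = (w, Q, k)" by (cases v)
  have vC: "w \<bullet> \<xi> + Q \<bullet> outer \<xi> \<xi> + k * g \<xi> < b" if "\<xi> \<in> W" for \<xi>
    using v(1)[of "f \<xi>"] that by (simp add: f_def vw inner_Pair hull_inc)
  have vT: "b < w \<bullet> \<mu> + Q \<bullet> (?R - N) + k * s" if "psd N" "F + \<delta> \<le> s" for N s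
    using v(2)[of "(\<mu>, ?R - N, s)"] that by (simp add: vw inner_Pair)
  have QN: "Q \<bullet> N \<le> 0" if "psd N" for N
  proof (rule nonpos_of_bounded_multiples)
    fix c :: real assume "0 \<le> c"
    from vT[OF psd_scaleR[OF that this], of "F + \<delta>"]
    show "c * (Q \<bullet> N) \<le> w \<bullet> \<mu> + Q \<bullet> ?R + k * (F + \<delta>) - b" by (simp add: inner_diff_right)
  qed
  have "- k \<le> 0"
  proof (rule nonpos_of_bounded_multiples)
    fix c :: real assume "0 \<le> c"
    then show "c * (- k) \<le> w \<bullet> \<mu> + Q \<bullet> ?R + k * (F + \<delta>) - b"
      using vT[OF psd_0, of "F + \<delta> + c"] by (simp add: algebra_simps)
  qed
  \<comment> \<open>A vertical hyperplane would separate the lifted point over \<open>\<mu>\<close>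
    from the admissible moments. But the point mass at \<open>\<mu>\<close> has admissible moments,
    as \<open>S\<close> is psd; this replaces a Slater point.\<close>
  moreover have "k \<noteq> 0"
  proof
    assume "k = 0"
    then show False using vC[OF \<mu>] vT[OF psd_0, of "F + \<delta>"] QN[OF S] by (simp add: inner_add_right)
  qed
  ultimately have k: "0 < k" by simp
  \<comment> \<open>The separating \<open>Q\<close> need not be symmetric. Only its pairing with
    symmetric matrices matters, and symmetrising preserves that.\<close>
  define \<Omega> where "\<Omega> = (- 1 / (2 * k)) *\<^sub>R (Q + transpose Q)"
  have \<Omega>N: "\<Omega> \<bullet> N = - (Q \<bullet> N) / k" if "transpose N = N" for N
    using that k by (simp add: \<Omega>_def inner_add_left inner_transpose)
  have sym: "transpose (outer x x) = outer x x" for x :: "real^'n"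
    by (rule psd_transpose[OF psd_outer])
  have quad: "x \<bullet> (\<Omega> *v x) = - (Q \<bullet> outer x x) / k" for x
    using \<Omega>N[OF sym, of x] by (simp add: inner_outer)
  show thesis
  proof (rule that[of \<Omega> "(- 1 / k) *\<^sub>R w" "b / k"])
    show "psd \<Omega>"
      unfolding psd_def
    proof
      show "transpose \<Omega> = \<Omega>" unfolding \<Omega>_def transpose_linear by (simp add: add.commute)
      show "\<forall>x. 0 \<le> x \<bullet> (\<Omega> *v x)" using QN[OF psd_outer] k by (simp add: quad divide_nonpos_pos)
    qed
    show "g \<xi> \<le> \<xi> \<bullet> (\<Omega> *v \<xi>) + ((- 1 / k) *\<^sub>R w) \<bullet> \<xi> + b / k" if "\<xi> \<in> W" for \<xi>
      using vC[OF that] k by (simp add: quad field_simps)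
    have "transpose ?R = ?R" by (simp add: transpose_linear sym psd_transpose[OF S])
    then have "?R \<bullet> \<Omega> = - (Q \<bullet> ?R) / k" by (simp only: inner_commute[of ?R] \<Omega>N)
    then show "b / k + \<mu> \<bullet> ((- 1 / k) *\<^sub>R w) + ?R \<bullet> \<Omega> \<le> F + \<delta>"
      using vT[OF psd_0, of "F + \<delta>"] k by (simp add: field_simps inner_commute[of \<mu>])
  qed
qed

text \<open>The sublevel sets of the members of \<open>H\<close> are compact intervals, so by the one-dimensional
  Helly theorem it suffices that any two of them meet; if two did not, separating in the plane would
  produce a mixture in \<open>H\<close> that stays above the level.\<close>

lemma minimax_real_line:
  fixes H :: "(real \<Rightarrow> real) set"
  assumes mix: "\<And>h k a b. \<lbrakk>h \<in> H; k \<in> H; 0 \<le> a; 0 \<le> b; a + b = 1\<rbrakk> \<Longrightarrow> (\<lambda>\<tau>. a * h \<tau> + b * k \<tau>) \<in> H"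
    and conv: "\<And>h. h \<in> H \<Longrightarrow> convex_on UNIV h"
    and coercive: "\<And>h \<tau>. h \<in> H \<Longrightarrow> \<tau> \<le> h \<tau>" "\<And>h \<tau>. h \<in> H \<Longrightarrow> A - \<kappa> * \<tau> \<le> h \<tau>" "0 < \<kappa>"
    and inf: "\<And>h. h \<in> H \<Longrightarrow> \<exists>\<tau>. h \<tau> < d"
  shows "\<exists>\<tau>. \<forall>h\<in>H. h \<tau> \<le> d"
proof (cases "H = {}")
  case False
  define T where "T h = {\<tau>. h \<tau> \<le> d}" for h :: "real \<Rightarrow> real"
  have meet: "T h \<inter> T k \<noteq> {}" if h: "h \<in> H" and k: "k \<in> H" for h k
  proof
    assume emp: "T h \<inter> T k = {}"
    \<comment> \<open>The region above and to the right of the curve (h \<tau>, k \<tau>); it is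
      convex because both functions are, and it misses the quadrant below (d, d) exactly when the
      sublevel sets are disjoint.\<close>
    let ?K = "{(x, y). \<exists>\<tau>. h \<tau> \<le> x \<and> k \<tau> \<le> y}"
    let ?Q = "{..d} \<times> {..d}"
    have "convex ?K"
      unfolding convex_def
    proof clarsimp
      fix x y x' y' u v \<tau> \<tau>' :: real
      assume *: "0 \<le> u" "0 \<le> v" "u + v = 1" "h \<tau> \<le> x" "k \<tau> \<le> y" "h \<tau>' \<le> x'" "k \<tau>' \<le> y'"
      have "r (u * \<tau> + v * \<tau>') \<le> u * r \<tau> + v * r \<tau>'" if "r \<in> H" for r
        using conv[OF that] * by (auto simp: convex_on_def)
      then have "h (u * \<tau> + v * \<tau>') \<le> u * h \<tau> + v * h \<tau>'" "k (u * \<tau> + v * \<tau>') \<le> u * k \<tau> + v * k \<tau>'"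
        using h k by auto
      moreover have "u * h \<tau> + v * h \<tau>' \<le> u * x + v * x'" "u * k \<tau> + v * k \<tau>' \<le> u * y + v * y'"
        using * by (auto intro!: add_mono mult_left_mono)
      ultimately show "\<exists>\<tau>. h \<tau> \<le> u * x + v * x' \<and> k \<tau> \<le> u * y + v * y'"
        by (meson order_trans)
    qed
    moreover have "convex ?Q" by (intro convex_Times) auto
    moreover have "?K \<noteq> {}" "?Q \<noteq> {}" by auto
    moreover have "?Q \<inter> ?K = {}"
    proof -
      have False if "h \<tau> \<le> x" "k \<tau> \<le> y" "x \<le> d" "y \<le> d" for x y \<tau>
        using emp that order_trans unfolding T_def by (metis (no_types, lifting) IntI empty_iff mem_Collect_eq)
      then show ?thesis by auto
    qed
    ultimately obtain s b where s: "s \<noteq> 0" "\<forall>x\<in>?Q. s \<bullet> x \<le> b" "\<forall>x\<in>?K. b \<le> s \<bullet> x"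
      using separating_hyperplane_sets[of ?Q ?K] by blast
    obtain p q where pq: "s = (p, q)" by (cases s)
    have Q: "p * x + q * y \<le> b" if "x \<le> d" "y \<le> d" for x y
      using s(2) that by (auto simp: pq inner_Pair)
    have "- p \<le> 0"
    proof (rule nonpos_of_bounded_multiples)
      fix c :: real assume "0 \<le> c"
      then show "c * (- p) \<le> b - p * d - q * d" using Q[of "d - c" d] by (simp add: algebra_simps)
    qed
    moreover have "- q \<le> 0"
    proof (rule nonpos_of_bounded_multiples)
      fix c :: real assume "0 \<le> c"
      then show "c * (- q) \<le> b - p * d - q * d" using Q[of d "d - c"] by (simp add: algebra_simps)
    qed
    ultimately have nn: "0 \<le> p" "0 \<le> q" "0 < p + q" using s(1) by (auto simp: pq zero_prod_def add_nonneg_pos add_pos_nonneg less_le)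
    \<comment> \<open>The quadrant is unbounded downwards in both coordinates, which makes the
      normal (p, q) nonnegative; normalised, it supplies the weights of the forbidden
      mixture.\<close>
    let ?a = "p / (p + q)" and ?b = "q / (p + q)"
    have "?a + ?b = 1" using nn by (simp add: add_divide_distrib[symmetric])
    then have "(\<lambda>\<tau>. ?a * h \<tau> + ?b * k \<tau>) \<in> H" using nn by (intro mix h k) auto
    then obtain \<tau> where "?a * h \<tau> + ?b * k \<tau> < d" using inf by blast
    then have "(p * h \<tau> + q * k \<tau>) / (p + q) < d" by (simp add: add_divide_distrib)
    then have "p * h \<tau> + q * k \<tau> < d * (p + q)" using nn by (simp add: pos_divide_less_eq)
    moreover have "b \<le> p * h \<tau> + q * k \<tau>" using s(3) by (auto simp: pq inner_Pair)
    ultimately show False using Q[of d d] by (simp add: algebra_simps)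
  qed
  have T: "T h \<noteq> {}" "closed (T h)" "convex (T h)" "bdd_below (T h)" "bdd_above (T h)" if h: "h \<in> H" for h
  proof -
    show "T h \<noteq> {}" using inf[OF h] unfolding T_def by (force intro: less_imp_le)
    have "continuous_on UNIV h" by (rule convex_on_continuous[OF open_UNIV conv[OF h]])
    then show "closed (T h)" unfolding T_def by (intro closed_Collect_le continuous_intros)
    show "convex (T h)"
      unfolding convex_def
    proof clarsimp
      fix x y u v :: real
      assume *: "x \<in> T h" "y \<in> T h" "0 \<le> u" "0 \<le> v" "u + v = 1"
      then have "h (u * x + v * y) \<le> u * h x + v * h y"
        using conv[OF h] by (auto simp: convex_on_def)
      also have "\<dots> \<le> u * d + v * d" using * by (intro add_mono mult_left_mono) (auto simp: T_def)
      also have "\<dots> = d" using * by (metis distrib_right mult_1)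
      finally show "u * x + v * y \<in> T h" by (simp add: T_def)
    qed
    show "bdd_above (T h)" unfolding T_def using coercive(1)[OF h] by (auto intro!: bdd_aboveI[of _ d] intro: order_trans)
    have "(A - d) / \<kappa> \<le> \<tau>" if "h \<tau> \<le> d" for \<tau>
    proof -
      have "A - d \<le> \<kappa> * \<tau>" using coercive(2)[OF h, of \<tau>] that by linarith
      then show ?thesis using coercive(3) by (simp add: pos_divide_le_eq mult.commute)
    qed
    then show "bdd_below (T h)" unfolding T_def by (auto intro!: bdd_belowI)
  qed
  have LU: "Inf (T h) \<le> Sup (T k)" if "h \<in> H" "k \<in> H" for h k
    using meet[OF that] T[OF that(1)] T[OF that(2)] by (meson IntE cInf_lower cSup_upper equals0I order_trans)
  \<comment> \<open>Pairwise intersection puts every left endpoint below every right endpoint, so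
    the supremum of the left endpoints lies in all the intervals.\<close>
  define \<tau> where "\<tau> = (SUP h\<in>H. Inf (T h))"
  have "h \<tau> \<le> d" if h: "h \<in> H" for h
  proof -
    have "Inf (T h) \<le> \<tau>" unfolding \<tau>_def
      using LU h by (intro cSUP_upper) (auto intro!: bdd_aboveI2)
    moreover have "\<tau> \<le> Sup (T h)" unfolding \<tau>_def using LU h False by (intro cSUP_least) auto
    moreover have "Inf (T h) \<in> T h" "Sup (T h) \<in> T h"
      using T[OF h] by (auto intro: closed_contains_Inf closed_contains_Sup)
    moreover have "is_interval (T h)" using T(3)[OF h] by (simp add: is_interval_convex_1)
    ultimately have "\<tau> \<in> T h" by (meson is_interval_1)
    then show ?thesis by (simp add: T_def)
  qed
  then show ?thesis by blast
qed auto

section \<open>Moments of the component measures\<close>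

text \<open>The mixture is known only through its values on Borel sets, so the identity is carried
  from indicators to sums, multiples and monotone limits.\<close>

lemma nn_integral_mixture:
  fixes P :: "'a::topological_space measure"
  assumes "finite J" and P: "sets P = sets borel" and \<rho>: "\<And>j. j \<in> J \<Longrightarrow> sets (\<rho> j) = sets borel"
    and em: "\<And>X. X \<in> sets borel \<Longrightarrow> emeasure P X = (\<Sum>j\<in>J. c j * emeasure (\<rho> j) X)"
    and g: "g \<in> borel_measurable borel"
  shows "(\<integral>\<^sup>+x. g x \<partial>P) = (\<Sum>j\<in>J. c j * (\<integral>\<^sup>+x. g x \<partial>\<rho> j))"
proof -
  have mP: "f \<in> borel_measurable P" if "f \<in> borel_measurable borel" for f :: "'a \<Rightarrow> ennreal"
    using that measurable_cong_sets[OF P refl] by blast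
  have m\<rho>: "f \<in> borel_measurable (\<rho> j)" if "f \<in> borel_measurable borel" "j \<in> J" for f :: "'a \<Rightarrow> ennreal" and j
    using that measurable_cong_sets[OF \<rho> refl] by blast
  show ?thesis using g
  proof (induction rule: borel_measurable_induct)
    case (cong f g)
    then have "f = g" by (simp add: fun_eq_iff)
    with cong show ?case by simp
  next
    case (set A)
    then show ?case using em[OF set] P \<rho> by (simp add: nn_integral_indicator)
  next
    case (mult u c')
    then show ?case
      by (simp add: nn_integral_cmult mP m\<rho> sum_distrib_left mult.left_commute cong: sum.cong)
  next
    case (add u v)
    then show ?case
      by (simp add: nn_integral_add mP m\<rho> sum.distrib distrib_left cong: sum.cong)
  next
    case (seq U)
    have "(\<integral>\<^sup>+x. (SUP i. U i) x \<partial>P) = (SUP i. \<integral>\<^sup>+x. U i x \<partial>P)"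
      unfolding SUP_apply by (intro nn_integral_monotone_convergence_SUP seq mP)
    also have "\<dots> = (SUP i. \<Sum>j\<in>J. c j * (\<integral>\<^sup>+x. U i x \<partial>\<rho> j))" by (simp add: seq)
    also have "\<dots> = (\<Sum>j\<in>J. SUP i. c j * (\<integral>\<^sup>+x. U i x \<partial>\<rho> j))"
      using seq by (intro ennreal_SUP_sum)
        (auto simp: incseq_def le_fun_def intro!: mult_left_mono nn_integral_mono)
    also have "\<dots> = (\<Sum>j\<in>J. c j * (\<integral>\<^sup>+x. (SUP i. U i) x \<partial>\<rho> j))"
      unfolding SUP_apply
      by (intro sum.cong refl)
        (simp add: SUP_mult_left_ennreal nn_integral_monotone_convergence_SUP seq m\<rho>)
    finally show ?case .
  qed
qed

lemma component_integrable:
  fixes g :: "real^'n \<Rightarrow> 'b::{banach, second_countable_topology}"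
  assumes W: "compact W" and \<rho>: "\<rho> \<in> component_set W \<mu> S"
    and g: "continuous_on W g" "g \<in> borel_measurable borel"
  shows "integrable \<rho> (\<lambda>x. indicator W x *\<^sub>R g x)"
proof -
  have s: "sets \<rho> = sets borel" and e: "emeasure \<rho> (- W) = 0" "emeasure \<rho> W = 1"
    using \<rho> by (auto simp: component_set_def)
  have Wb: "W \<in> sets borel" using W by (simp add: compact_imp_closed)
  have "emeasure \<rho> (W \<union> - W) = emeasure \<rho> W + emeasure \<rho> (- W)"
    using Wb s by (intro plus_emeasure[symmetric]) auto
  then have "emeasure \<rho> (space \<rho>) = 1" using e sets_eq_imp_space_eq[OF s] by (simp add: Compl_partition)
  then interpret finite_measure \<rho> by (intro finite_measureI) simp
  have "bounded (g ` W)" using W g(1) by (intro compact_imp_bounded compact_continuous_image)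
  then obtain B where B: "\<And>x. x \<in> W \<Longrightarrow> norm (g x) \<le> B" "0 < B"
    unfolding bounded_pos by auto
  show ?thesis
  proof (rule integrable_const_bound[of _ B])
    show "AE x in \<rho>. norm (indicator W x *\<^sub>R g x) \<le> B"
      using B by (auto intro!: AE_I2 simp: indicator_def less_imp_le)
    show "(\<lambda>x. indicator W x *\<^sub>R g x) \<in> borel_measurable \<rho>"
      using Wb g(2) unfolding measurable_cong_sets[OF s refl] by measurable
  qed
qed

lemma component_integral_quadratic:
  fixes \<Omega> :: "real^'n^'n"
  assumes W: "compact W" and \<rho>: "\<rho> \<in> component_set W \<mu> S"
  shows "(\<integral>x. indicator W x *\<^sub>R (x \<bullet> (\<Omega> *v x) + \<omega> \<bullet> x + t) \<partial>\<rho>)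
    = \<Omega> \<bullet> (LINT x:W|\<rho>. outer x x) + \<omega> \<bullet> \<mu> + t"
proof -
  note int = component_integrable[OF W \<rho>]
  have i1: "integrable \<rho> (\<lambda>x. indicator W x *\<^sub>R outer x x)" by (intro int continuous_outer) simp
  have i2: "integrable \<rho> (\<lambda>x. indicator W x *\<^sub>R x)" by (intro int continuous_intros) simp
  have i3: "integrable \<rho> (\<lambda>x. indicator W x *\<^sub>R t)" by (intro int continuous_intros) simp
  have "(\<integral>x. indicator W x *\<^sub>R (x \<bullet> (\<Omega> *v x) + \<omega> \<bullet> x + t) \<partial>\<rho>)
    = (\<integral>x. \<Omega> \<bullet> (indicator W x *\<^sub>R outer x x) + \<omega> \<bullet> (indicator W x *\<^sub>R x) + indicator W x *\<^sub>R t \<partial>\<rho>)"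
    by (intro Bochner_Integration.integral_cong refl) (simp add: inner_outer algebra_simps)
  also have "\<dots> = (\<integral>x. \<Omega> \<bullet> (indicator W x *\<^sub>R outer x x) \<partial>\<rho>) + (\<integral>x. \<omega> \<bullet> (indicator W x *\<^sub>R x) \<partial>\<rho>)
      + (\<integral>x. indicator W x *\<^sub>R t \<partial>\<rho>)"
    using integrable_inner_right[of \<Omega>, OF i1] integrable_inner_right[of \<omega>, OF i2] i3
    by (simp only: Bochner_Integration.integral_add Bochner_Integration.integrable_add)
  also have "\<dots> = \<Omega> \<bullet> (\<integral>x. indicator W x *\<^sub>R outer x x \<partial>\<rho>) + \<omega> \<bullet> (\<integral>x. indicator W x *\<^sub>R x \<partial>\<rho>)
      + (\<integral>x. indicator W x *\<^sub>R t \<partial>\<rho>)"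
    by (simp only: integral_inner_right[OF i1] integral_inner_right[OF i2])
  also have "(\<integral>x. indicator W x *\<^sub>R t \<partial>\<rho>) = measure \<rho> W * t"
    using \<rho> W by (simp add: component_set_def compact_imp_closed sets_eq_imp_space_eq[of \<rho> borel])
  finally show ?thesis using \<rho> by (simp add: component_set_def measure_def set_lebesgue_integral_def)
qed

text \<open>Weak duality for one component. Replacing the second moment by its Loewner bound can
  only raise the integral of the majorant, since psd matrices pair nonnegatively. That
  \<open>c\<close> is nonnegative is recorded because \<open>ennreal\<close> would send a negative
  price to 0.\<close>

lemma component_nn_integral_le:
  fixes g :: "real^'n \<Rightarrow> real"
  assumes W: "compact W" and \<rho>: "\<rho> \<in> component_set W \<mu> S" and \<Omega>: "psd \<Omega>"
    and g: "\<And>x. x \<in> W \<Longrightarrow> 0 \<le> g x" "\<And>x. x \<in> W \<Longrightarrow> g x \<le> x \<bullet> (\<Omega> *v x) + \<omega> \<bullet> x + t"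
  defines "c \<equiv> t + \<mu> \<bullet> \<omega> + (S + outer \<mu> \<mu>) \<bullet> \<Omega>"
  shows "0 \<le> c" "(\<integral>\<^sup>+x. ennreal (g x) \<partial>\<rho>) \<le> ennreal c"
proof -
  let ?q = "\<lambda>x. x \<bullet> (\<Omega> *v x) + \<omega> \<bullet> x + t"
  let ?Q = "LINT x:W|\<rho>. outer x x"
  have s: "sets \<rho> = sets borel" and e: "emeasure \<rho> (- W) = 0"
    and le: "psd (S + outer \<mu> \<mu> - ?Q)"
    using \<rho> by (auto simp: component_set_def loewner_le_def)
  have AEW: "AE x in \<rho>. x \<in> W"
    using e s W by (intro AE_I[of _ _ "- W"]) (auto simp: compact_imp_closed)
  have q: "continuous_on A ?q" for A by (intro continuous_intros)
  have int: "integrable \<rho> (\<lambda>x. indicator W x *\<^sub>R ?q x)"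
    by (intro component_integrable[OF W \<rho>] q borel_measurable_continuous_onI)
  have nn: "0 \<le> indicator W x *\<^sub>R ?q x" for x
    using order_trans[OF g(1) g(2), of x] by (simp add: indicator_def)
  have "(\<integral>x. indicator W x *\<^sub>R ?q x \<partial>\<rho>) = \<Omega> \<bullet> ?Q + \<omega> \<bullet> \<mu> + t"
    by (rule component_integral_quadratic[OF W \<rho>])
  also have "\<dots> \<le> c"
    using psd_inner_nonneg[OF le \<Omega>] by (simp add: c_def inner_diff_right inner_commute)
  finally have I: "(\<integral>x. indicator W x *\<^sub>R ?q x \<partial>\<rho>) \<le> c" .
  show "0 \<le> c" using order_trans[OF Bochner_Integration.integral_nonneg I] nn by blast
  have "(\<integral>\<^sup>+x. ennreal (g x) \<partial>\<rho>) \<le> (\<integral>\<^sup>+x. ennreal (indicator W x *\<^sub>R ?q x) \<partial>\<rho>)"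
    using AEW g(2) by (intro nn_integral_mono_AE) (auto elim!: eventually_mono intro!: ennreal_leI)
  also have "\<dots> = ennreal (\<integral>x. indicator W x *\<^sub>R ?q x \<partial>\<rho>)"
    using int nn by (intro nn_integral_eq_integral) auto
  also have "\<dots> \<le> ennreal c" using I by (rule ennreal_leI)
  finally show "(\<integral>\<^sup>+x. ennreal (g x) \<partial>\<rho>) \<le> ennreal c" .
qed

text \<open>The slack of a row is a quadratic with matrix 0 that is nonnegative on the polyhedron;
  its integral is the slack at the mean.\<close>

lemma component_mean_in:
  assumes bdd: "bounded (polyhedron_of E f)" and \<rho>: "\<rho> \<in> component_set (polyhedron_of E f) \<mu> S"
  shows "\<mu> \<in> polyhedron_of E f"
proof -
  let ?W = "polyhedron_of E f"
  have W: "compact ?W" using bdd closed_polyhedron_of compact_eq_bounded_closed by blast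
  have "E $ i \<bullet> \<mu> \<le> f $ i" for i
  proof -
    have "0 \<le> (\<integral>x. indicator ?W x *\<^sub>R (x \<bullet> ((0::real^_^_) *v x) + (- E $ i) \<bullet> x + f $ i) \<partial>\<rho>)"
      by (intro Bochner_Integration.integral_nonneg)
        (auto simp: indicator_def polyhedron_of_def less_eq_vec_def matrix_vector_mul_component)
    then show ?thesis by (simp only: component_integral_quadratic[OF W \<rho>]) simp
  qed
  then show ?thesis by (simp add: polyhedron_of_def less_eq_vec_def matrix_vector_mul_component)
qed

section \<open>Worst-case CVaR and the semidefinite program\<close>

text \<open>The infimum need not be known to be attained, hence the slack \<open>\<delta>\<close>
  and the strict inequality.\<close>

lemma CVaR_le_iff:
  "CVaR P \<epsilon> L \<le> ereal c \<longleftrightarrow> (\<forall>\<delta>>0. \<exists>\<beta>. ereal \<beta> + ereal (1 / \<epsilon>) *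
     enn2ereal (\<integral>\<^sup>+ \<xi>. ennreal (max (L \<xi> - \<beta>) 0) \<partial>P) < ereal (c + \<delta>))" (is "_ \<longleftrightarrow> ?R")
proof
  assume l: "CVaR P \<epsilon> L \<le> ereal c"
  show ?R
  proof (intro allI impI)
    fix \<delta> :: real assume "0 < \<delta>"
    then have "CVaR P \<epsilon> L < ereal (c + \<delta>)" using l by (simp add: order_le_less_trans)
    then show "\<exists>\<beta>. ereal \<beta> + ereal (1 / \<epsilon>) *
     enn2ereal (\<integral>\<^sup>+ \<xi>. ennreal (max (L \<xi> - \<beta>) 0) \<partial>P) < ereal (c + \<delta>)"
      by (simp add: CVaR_def INF_less_iff)
  qed
next
  assume r: ?R
  show "CVaR P \<epsilon> L \<le> ereal c"
  proof (rule ereal_le_epsilon2)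
    fix \<delta> :: real assume "0 < \<delta>"
    with r have "CVaR P \<epsilon> L < ereal (c + \<delta>)" by (simp add: CVaR_def INF_less_iff)
    then show "CVaR P \<epsilon> L \<le> ereal c + ereal \<delta>" by simp
  qed
qed

text \<open>Substitute \<beta> + d for \<beta>. The converse is the same implication applied to the
  shifted loss with -d.\<close>

lemma CVaR_shift: "CVaR P \<epsilon> (\<lambda>\<xi>. L \<xi> + d) \<le> ereal (c + d) \<longleftrightarrow> CVaR P \<epsilon> L \<le> ereal c"
proof -
  have *: "CVaR P \<epsilon> (\<lambda>\<xi>. L \<xi> + d) \<le> ereal (c + d)" if "CVaR P \<epsilon> L \<le> ereal c" for L d c
    unfolding CVaR_le_iff
  proof (intro allI impI)
    fix \<delta> :: real assume "0 < \<delta>"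
    then obtain \<beta> where "ereal \<beta> + ereal (1 / \<epsilon>) *
     enn2ereal (\<integral>\<^sup>+ \<xi>. ennreal (max (L \<xi> - \<beta>) 0) \<partial>P) < ereal (c + \<delta>)"
      using \<open>CVaR P \<epsilon> L \<le> ereal c\<close> unfolding CVaR_le_iff by blast
    then have "ereal (\<beta> + d) + ereal (1 / \<epsilon>) *
     enn2ereal (\<integral>\<^sup>+ \<xi>. ennreal (max (L \<xi> + d - (\<beta> + d)) 0) \<partial>P) < ereal (c + d + \<delta>)"
      by (cases "ereal (1 / \<epsilon>) * enn2ereal (\<integral>\<^sup>+ \<xi>. ennreal (max (L \<xi> - \<beta>) 0) \<partial>P)") auto
    then show "\<exists>\<beta>. ereal \<beta> + ereal (1 / \<epsilon>) *
     enn2ereal (\<integral>\<^sup>+ \<xi>. ennreal (max (L \<xi> + d - \<beta>) 0) \<partial>P) < ereal (c + d + \<delta>)" by blast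
  qed
  show ?thesis using *[of L c d] *[of "\<lambda>\<xi>. L \<xi> + d" "c + d" "- d"] by auto
qed

section \<open>Worst-case CVaR against the semidefinite program\<close>

lemma sdp_feasible_imp_CVaR_le:
  fixes E :: "real^'n^'q"
  assumes bdd: "bounded (polyhedron_of E f)" and \<epsilon>: "0 < \<epsilon>"
    and \<gamma>: "\<And>j. j < m \<Longrightarrow> 0 \<le> \<gamma> j"
    and P: "P \<in> ambiguity_set (polyhedron_of E f) m \<gamma> \<mu> S"
    and feas: "sdp_feasible E f m \<gamma> \<mu> S a \<epsilon> \<eta> \<beta> t \<omega> \<Omega> \<phi> \<psi>"
  shows "CVaR P \<epsilon> (\<lambda>\<xi>. a \<bullet> \<xi>) \<le> ereal \<eta>"
proof -
  let ?W = "polyhedron_of E f"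
  have W: "compact ?W" using bdd closed_polyhedron_of compact_eq_bounded_closed by blast
  \<comment> \<open>The threshold at which CVaR is tested. The cost row bounds the expected excess
    by -\<epsilon>\<beta>, so the objective at this threshold is at most \<tau> - \<beta> =
    \<eta>.\<close>
  define \<tau> where "\<tau> = \<beta> + \<eta>"
  let ?g = "\<lambda>\<xi>. max (a \<bullet> \<xi> - \<tau>) 0"
  define c where "c = (\<lambda>j. t j + \<mu> j \<bullet> \<omega> j + (S j + outer (\<mu> j) (\<mu> j)) \<bullet> \<Omega> j)"
  obtain \<rho> where sP: "sets P = sets borel" and \<rho>: "\<And>j. j < m \<Longrightarrow> \<rho> j \<in> component_set ?W (\<mu> j) (S j)"
    and em: "\<And>X. X \<in> sets borel \<Longrightarrow> emeasure P X = (\<Sum>j<m. ennreal (\<gamma> j) * emeasure (\<rho> j) X)"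
    using P unfolding ambiguity_set_def by blast
  have comp: "0 \<le> c j" "(\<integral>\<^sup>+x. ennreal (?g x) \<partial>\<rho> j) \<le> ennreal (c j)" if j: "j < m" for j
  proof -
    have p: "psd (bordered (\<Omega> j) ((1/2) *\<^sub>R (\<omega> j + transpose E *v \<phi> j)) (t j - f \<bullet> \<phi> j))"
      "psd (bordered (\<Omega> j) ((1/2) *\<^sub>R ((\<omega> j - a) + transpose E *v \<psi> j)) ((t j + \<tau>) - f \<bullet> \<psi> j))"
      "psd (\<Omega> j)" "0 \<le> \<phi> j" "0 \<le> \<psi> j"
      using feas j by (auto simp: sdp_feasible_def \<tau>_def add.assoc)
    have "?g x \<le> x \<bullet> (\<Omega> j *v x) + \<omega> j \<bullet> x + t j" if "x \<in> ?W" for x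
      using polyhedron_quadratic_nonneg[OF p(1,4) that] polyhedron_quadratic_nonneg[OF p(2,5) that]
      by (simp add: inner_diff_left)
    then show "0 \<le> c j" "(\<integral>\<^sup>+x. ennreal (?g x) \<partial>\<rho> j) \<le> ennreal (c j)"
      unfolding c_def by (intro component_nn_integral_le[OF W \<rho>[OF j] p(3), of ?g]; simp)+
  qed
  have "(\<integral>\<^sup>+x. ennreal (?g x) \<partial>P) = (\<Sum>j<m. ennreal (\<gamma> j) * (\<integral>\<^sup>+x. ennreal (?g x) \<partial>\<rho> j))"
    using \<rho> by (intro nn_integral_mixture sP em) (auto simp: component_set_def)
  also have "\<dots> \<le> (\<Sum>j<m. ennreal (\<gamma> j) * ennreal (c j))"
    using comp by (intro sum_mono mult_left_mono) auto
  also have "\<dots> = (\<Sum>j<m. ennreal (\<gamma> j * c j))" using comp \<gamma> by (simp add: ennreal_mult)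
  also have "\<dots> = ennreal (\<Sum>j<m. \<gamma> j * c j)" using comp \<gamma> by (intro sum_ennreal) auto
  finally have "enn2ereal (\<integral>\<^sup>+x. ennreal (?g x) \<partial>P) \<le> enn2ereal (ennreal (\<Sum>j<m. \<gamma> j * c j))"
    by (simp add: less_eq_ennreal.rep_eq)
  also have "\<dots> = ereal (\<Sum>j<m. \<gamma> j * c j)"
    using comp \<gamma> by (intro enn2ereal_ennreal sum_nonneg) auto
  also have "\<dots> \<le> ereal (- (\<epsilon> * \<beta>))" using feas by (simp add: sdp_feasible_def c_def)
  finally have "ereal (1 / \<epsilon>) * enn2ereal (\<integral>\<^sup>+x. ennreal (?g x) \<partial>P) \<le> ereal (1 / \<epsilon>) * ereal (- (\<epsilon> * \<beta>))"
    using \<epsilon> by (intro ereal_mult_left_mono) auto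
  also have "\<dots> = ereal (- \<beta>)" using \<epsilon> by simp
  finally have "ereal \<tau> + ereal (1 / \<epsilon>) * enn2ereal (\<integral>\<^sup>+x. ennreal (?g x) \<partial>P) \<le> ereal \<tau> + ereal (- \<beta>)"
    by (rule add_left_mono)
  also have "\<dots> = ereal \<eta>" by (simp add: \<tau>_def)
  finally show ?thesis unfolding CVaR_def by (meson INF_lower2 UNIV_I)
qed

text \<open>Every finitely supported mixture has its own good threshold; minimax makes one threshold
  good for all of them. At that threshold the components decouple, and each one is priced by moment
  duality.\<close>

lemma CVaR_le_imp_sdp_feasible:
  fixes E :: "real^'n^'q" and a :: "real^'n"
  assumes bdd: "bounded (polyhedron_of E f)" and \<epsilon>: "0 < \<epsilon>" "\<epsilon> < 1"
    and \<gamma>: "\<And>j. j < m \<Longrightarrow> 0 \<le> \<gamma> j" "(\<Sum>j<m. \<gamma> j) = 1"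
    and S: "\<And>j. j < m \<Longrightarrow> psd (S j)"
    and \<mu>: "\<And>j. j < m \<Longrightarrow> \<mu> j \<in> polyhedron_of E f"
    and CV: "\<And>P. P \<in> ambiguity_set (polyhedron_of E f) m \<gamma> \<mu> S \<Longrightarrow> CVaR P \<epsilon> (\<lambda>\<xi>. a \<bullet> \<xi>) \<le> ereal c"
    and \<delta>: "0 < \<delta>"
  shows "\<exists>\<beta> t \<omega> \<Omega> \<phi> \<psi>. sdp_feasible E f m \<gamma> \<mu> S a \<epsilon> (c + \<delta>) \<beta> t \<omega> \<Omega> \<phi> \<psi>"
proof -
  let ?W = "polyhedron_of E f"
  have W: "compact ?W" using bdd closed_polyhedron_of compact_eq_bounded_closed by blast
  have Wb: "?W \<in> sets borel" by (rule borel_closed[OF closed_polyhedron_of])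
  have m: "0 < m" using \<gamma>(2) by (cases m) auto
  then have ne: "?W \<noteq> {}" using \<mu> by blast
  \<comment> \<open>The error budget: one \<open>\<kappa>\<close> for the common threshold and,
    divided by \<open>\<epsilon>\<close>, one for near-maximising laws and one for the duality gap;
    together they make up \<open>\<delta>\<close>.\<close>
  define \<kappa> where "\<kappa> = \<delta> / (1 + 2 / \<epsilon>)"
  have \<kappa>: "0 < \<kappa>" using \<delta> \<epsilon> by (simp add: \<kappa>_def add_pos_pos)
  have "\<kappa> * (1 + 2 / \<epsilon>) = \<delta>" using \<epsilon> by (simp add: \<kappa>_def add_pos_pos less_imp_neq[symmetric])
  then have \<kappa>\<delta>: "\<kappa> + (1 / \<epsilon>) * (\<kappa> + \<kappa>) = \<delta>" by (simp add: algebra_simps)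
  define g where "g = (\<lambda>\<tau> \<xi>. max (a \<bullet> \<xi> - \<tau>) 0)"
  have gm: "g \<tau> \<in> borel_measurable borel" for \<tau> unfolding g_def by measurable
  have gc: "continuous_on A (g \<tau>)" for A \<tau> unfolding g_def by (intro continuous_intros)
  define \<P> where "\<P> = {p. \<forall>j<m. p j \<in> fin_component ?W (\<mu> j) (S j)}"
  \<comment> \<open>The CVaR objective of the mixture at threshold \<tau>: affine in the family
    \<open>p\<close> and convex in \<open>\<tau>\<close>, as minimax requires.\<close>
  define G where "G = (\<lambda>p \<tau>. \<tau> + (1 / \<epsilon>) * (\<Sum>j<m. \<gamma> j * expect (p j) (g \<tau>)))"
  have fp: "p j \<in> fin_prob ?W" "finite {x. p j x \<noteq> 0}" "0 \<le> p j x"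
    if "p \<in> \<P>" "j < m" for p j x
    using that by (auto simp: \<P>_def fin_component_def fin_prob_def)
  have "bounded ((\<bullet>) a ` ?W)"
    using W by (intro compact_imp_bounded compact_continuous_image continuous_intros)
  then obtain R where R: "\<And>x. x \<in> ?W \<Longrightarrow> \<bar>a \<bullet> x\<bar> \<le> R" unfolding bounded_iff by auto
  have nng: "0 \<le> (\<Sum>j<m. \<gamma> j * expect (p j) (g \<tau>))" if "p \<in> \<P>" for p \<tau>
  proof (intro sum_nonneg mult_nonneg_nonneg \<gamma>)
    fix j assume "j \<in> {..<m}"
    then show "0 \<le> expect (p j) (g \<tau>)"
      using expect_mono[OF fp(1)[OF that], of j "\<lambda>_. 0" "g \<tau>"] expect_const[OF fp(1)[OF that], of j 0]
      by (simp add: g_def)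
  qed auto
  have "\<exists>\<tau>. \<forall>h\<in>G ` \<P>. h \<tau> \<le> c + \<kappa>"
  \<comment> \<open>On W the excess is at least -R - \<tau>, so the objective is at least
    -R/\<epsilon> - (1/\<epsilon> - 1) \<tau>. This line is decreasing because \<epsilon> < 1, and
    it keeps thresholds from escaping to minus infinity.\<close>
  proof (rule minimax_real_line[where A = "- R / \<epsilon>" and \<kappa> = "1 / \<epsilon> - 1"])
    show "0 < 1 / \<epsilon> - 1" using \<epsilon> by simp
  next
    fix h k and u v :: real
    assume "h \<in> G ` \<P>" "k \<in> G ` \<P>" and uv: "0 \<le> u" "0 \<le> v" "u + v = 1"
    then obtain p q where pq: "p \<in> \<P>" "q \<in> \<P>" and hk: "h = G p" "k = G q" by auto
    let ?r = "\<lambda>j x. u * p j x + v * q j x"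
    have "?r \<in> \<P>" using pq uv by (auto simp: \<P>_def intro: fin_component_mix)
    moreover have "u * G p \<tau> + v * G q \<tau> = G ?r \<tau>" for \<tau>
    proof -
      have "(\<Sum>j<m. \<gamma> j * expect (?r j) (g \<tau>))
        = (\<Sum>j<m. u * (\<gamma> j * expect (p j) (g \<tau>)) + v * (\<gamma> j * expect (q j) (g \<tau>)))"
        using fp(2)[OF pq(1)] fp(2)[OF pq(2)]
        by (intro sum.cong refl) (simp add: expect_lincomb algebra_simps)
      then have "G ?r \<tau> = (u + v) * \<tau> + (1 / \<epsilon>) * (u * (\<Sum>j<m. \<gamma> j * expect (p j) (g \<tau>))
          + v * (\<Sum>j<m. \<gamma> j * expect (q j) (g \<tau>)))"
        by (simp only: G_def sum.distrib sum_distrib_left[symmetric] uv(3) mult_1)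
      then show ?thesis by (simp add: G_def algebra_simps)
    qed
    ultimately show "(\<lambda>\<tau>. u * h \<tau> + v * k \<tau>) \<in> G ` \<P>" unfolding hk by auto
  next
    fix h assume "h \<in> G ` \<P>"
    then obtain p where p: "p \<in> \<P>" "h = G p" by auto
    show "convex_on UNIV h"
      unfolding convex_on_def p(2)
    proof (intro conjI ballI allI impI)
      fix x y u v :: real assume uv: "0 \<le> u" "0 \<le> v" "u + v = 1"
      have pt: "g (u * x + v * y) \<xi> \<le> u *\<^sub>R g x \<xi> + v *\<^sub>R g y \<xi>" for \<xi>
      proof -
        have "a \<bullet> \<xi> - (u * x + v * y) = (u + v) * (a \<bullet> \<xi>) - (u * x + v * y)" using uv by simp
        also have "\<dots> = u * (a \<bullet> \<xi> - x) + v * (a \<bullet> \<xi> - y)" by (simp add: algebra_simps)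
        also have "\<dots> \<le> u *\<^sub>R g x \<xi> + v *\<^sub>R g y \<xi>"
          using uv by (auto simp: g_def intro!: add_mono mult_left_mono)
        finally show ?thesis using uv by (simp add: g_def)
      qed
      have "(\<Sum>j<m. \<gamma> j * expect (p j) (g (u * x + v * y)))
        \<le> (\<Sum>j<m. \<gamma> j * (u * expect (p j) (g x) + v * expect (p j) (g y)))"
      proof (intro sum_mono mult_left_mono)
        fix j assume "j \<in> {..<m}"
        then have "expect (p j) (g (u * x + v * y)) \<le> expect (p j) (\<lambda>\<xi>. u *\<^sub>R g x \<xi> + v *\<^sub>R g y \<xi>)"
          by (intro expect_mono[OF fp(1)[OF p(1)]] pt) simp
        then show "expect (p j) (g (u * x + v * y)) \<le> u * expect (p j) (g x) + v * expect (p j) (g y)"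
          by (simp only: expect_linear) simp
      qed (use \<gamma> in auto)
      then have "(1 / \<epsilon>) * (\<Sum>j<m. \<gamma> j * expect (p j) (g (u * x + v * y)))
        \<le> (1 / \<epsilon>) * (\<Sum>j<m. \<gamma> j * (u * expect (p j) (g x) + v * expect (p j) (g y)))"
        using \<epsilon> by (intro mult_left_mono) auto
      also have "\<dots> = u * ((1 / \<epsilon>) * (\<Sum>j<m. \<gamma> j * expect (p j) (g x)))
          + v * ((1 / \<epsilon>) * (\<Sum>j<m. \<gamma> j * expect (p j) (g y)))"
        by (simp add: sum.distrib sum_distrib_left algebra_simps)
      finally show "G p (u *\<^sub>R x + v *\<^sub>R y) \<le> u * G p x + v * G p y"
        by (simp add: G_def algebra_simps)
    qed simp
    show "\<tau> \<le> h \<tau>" for \<tau> using nng[OF p(1)] \<epsilon> by (simp add: p(2) G_def)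
    show "- R / \<epsilon> - (1 / \<epsilon> - 1) * \<tau> \<le> h \<tau>" for \<tau>
    proof -
      have "(\<Sum>j<m. \<gamma> j * (- R - \<tau>)) \<le> (\<Sum>j<m. \<gamma> j * expect (p j) (g \<tau>))"
      proof (intro sum_mono mult_left_mono)
        fix j assume "j \<in> {..<m}"
        then have pj: "p j \<in> fin_prob ?W" using fp(1)[OF p(1)] by simp
        have "expect (p j) (\<lambda>_. - R - \<tau>) \<le> expect (p j) (g \<tau>)"
          using R by (intro expect_mono[OF pj]) (force simp: g_def max_def abs_le_iff)
        then show "- R - \<tau> \<le> expect (p j) (g \<tau>)" by (simp add: expect_const[OF pj])
      qed (use \<gamma> in auto)
      then have "- R - \<tau> \<le> (\<Sum>j<m. \<gamma> j * expect (p j) (g \<tau>))"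
        by (simp add: sum_distrib_right[symmetric] \<gamma>(2))
      then have "(1 / \<epsilon>) * (- R - \<tau>) \<le> (1 / \<epsilon>) * (\<Sum>j<m. \<gamma> j * expect (p j) (g \<tau>))"
        using \<epsilon> by (intro mult_left_mono) auto
      then show ?thesis by (simp add: p(2) G_def algebra_simps diff_divide_distrib)
    qed
    show "\<exists>\<tau>. h \<tau> < c + \<kappa>"
    proof -
      let ?P = "\<lambda>x. \<Sum>j<m. \<gamma> j * p j x"
      have "fin_measure ?P \<in> ambiguity_set ?W m \<gamma> \<mu> S"
        using p(1) by (intro fin_ambiguity Wb \<gamma>(1)) (auto simp: \<P>_def)
      from CV[OF this] \<kappa> obtain \<tau> where \<tau>: "ereal \<tau> + ereal (1 / \<epsilon>) *
        enn2ereal (\<integral>\<^sup>+ \<xi>. ennreal (g \<tau> \<xi>) \<partial>fin_measure ?P) < ereal (c + \<kappa>)"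
        unfolding CVaR_le_iff g_def by blast
      have "finite (\<Union>j<m. {x. p j x \<noteq> 0})" using fp(2)[OF p(1)] by auto
      then have fin: "finite {x. ?P x \<noteq> 0}" by (rule finite_subset[OF support_sum_subset])
      have nn: "0 \<le> ?P x" for x using fp(3)[OF p(1)] \<gamma>(1) by (intro sum_nonneg) auto
      have "(\<integral>\<^sup>+ \<xi>. ennreal (g \<tau> \<xi>) \<partial>fin_measure ?P) = ennreal (expect ?P (g \<tau>))"
        by (intro nn_integral_fin_measure fin nn gm) (simp add: g_def)
      also have "expect ?P (g \<tau>) = (\<Sum>j<m. \<gamma> j *\<^sub>R expect (p j) (g \<tau>))"
        using fp(2)[OF p(1)] by (intro expect_sum) auto
      finally have "h \<tau> < c + \<kappa>"
        using \<tau> nng[OF p(1)] by (simp add: enn2ereal_ennreal p(2) G_def)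
      then show ?thesis by blast
    qed
  qed
  then obtain \<tau> where \<tau>: "\<And>p. p \<in> \<P> \<Longrightarrow> G p \<tau> \<le> c + \<kappa>" by blast
  define F where "F = (\<lambda>j. SUP p\<in>fin_component ?W (\<mu> j) (S j). expect p (g \<tau>))"
  \<comment> \<open>The point mass at the mean makes the component nonempty, so that
    \<open>F j\<close> is a genuine real supremum.\<close>
  have pt: "(\<lambda>x. if x = \<mu> j then 1 else 0) \<in> fin_component ?W (\<mu> j) (S j)" if "j < m" for j
    using fin_prob_point[OF \<mu>[OF that]] S[OF that]
    by (simp add: fin_component_def expect_point loewner_le_def)
  have bdda: "bdd_above ((\<lambda>p. expect p (g \<tau>)) ` fin_component ?W (\<mu> j) (S j))" for j
  proof (rule bdd_aboveI2)
    fix p assume "p \<in> fin_component ?W (\<mu> j) (S j)"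
    then have pj: "p \<in> fin_prob ?W" by (simp add: fin_component_def)
    have "expect p (g \<tau>) \<le> expect p (\<lambda>_. R + \<bar>\<tau>\<bar>)"
      using R by (intro expect_mono[OF pj]) (force simp: g_def max_def abs_le_iff)
    then show "expect p (g \<tau>) \<le> R + \<bar>\<tau>\<bar>" by (simp add: expect_const[OF pj])
  qed
  \<comment> \<open>The components are chosen independently, so a single family is nearly optimal in
    all of them at once; the bound at \<open>\<tau>\<close> for this family then controls the
    weighted sum of the \<open>F j\<close>.\<close>
  have "\<exists>p. \<forall>j<m. p j \<in> fin_component ?W (\<mu> j) (S j) \<and> F j - \<kappa> < expect (p j) (g \<tau>)"
  proof -
    have "\<exists>p. j < m \<longrightarrow> p \<in> fin_component ?W (\<mu> j) (S j) \<and> F j - \<kappa> < expect p (g \<tau>)" for j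
    proof (cases "j < m")
      case True
      have "F j - \<kappa> < F j" using \<kappa> by simp
      then show ?thesis
        using less_cSUP_iff[OF _ bdda, of j] pt[OF True] unfolding F_def by blast
    qed auto
    then show ?thesis by metis
  qed
  then obtain p where p: "p \<in> \<P>" "\<And>j. j < m \<Longrightarrow> F j - \<kappa> \<le> expect (p j) (g \<tau>)"
    unfolding \<P>_def by (auto intro: less_imp_le)
  have "\<exists>t \<omega> \<Omega> \<phi> \<psi>. j < m \<longrightarrow>
      t + \<mu> j \<bullet> \<omega> + (S j + outer (\<mu> j) (\<mu> j)) \<bullet> \<Omega> \<le> F j + \<kappa> \<and>
      psd (bordered \<Omega> ((1/2) *\<^sub>R (\<omega> + transpose E *v \<phi>)) (t - f \<bullet> \<phi>)) \<and>
      psd (bordered \<Omega> ((1/2) *\<^sub>R (\<omega> - a + transpose E *v \<psi>)) (t + \<tau> - f \<bullet> \<psi>)) \<and>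
      psd \<Omega> \<and> 0 \<le> \<phi> \<and> 0 \<le> \<psi>" for j
  proof (cases "j < m")
    case True
    have "expect p (g \<tau>) \<le> F j" if "p \<in> fin_component ?W (\<mu> j) (S j)" for p
      unfolding F_def by (intro cSUP_upper that bdda)
    from moment_duality[OF W \<mu>[OF True] S[OF True] gc this \<kappa>]
    obtain t \<omega> \<Omega> where \<Omega>: "psd \<Omega>" and le: "\<And>\<xi>. \<xi> \<in> ?W \<Longrightarrow> g \<tau> \<xi> \<le> \<xi> \<bullet> (\<Omega> *v \<xi>) + \<omega> \<bullet> \<xi> + t"
      and cost: "t + \<mu> j \<bullet> \<omega> + (S j + outer (\<mu> j) (\<mu> j)) \<bullet> \<Omega> \<le> F j + \<kappa>" by metis
    have "0 \<le> y \<bullet> (\<Omega> *v y) + \<omega> \<bullet> y + t" if "y \<in> ?W" for y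
      using le[OF that] by (simp add: g_def)
    then obtain \<phi> where \<phi>: "0 \<le> \<phi>" "psd (bordered \<Omega> ((1/2) *\<^sub>R (\<omega> + transpose E *v \<phi>)) (t - f \<bullet> \<phi>))"
      using convex_quadratic_multiplier[OF ne bdd \<Omega>] by metis
    have "0 \<le> y \<bullet> (\<Omega> *v y) + (\<omega> - a) \<bullet> y + (t + \<tau>)" if "y \<in> ?W" for y
      using le[OF that] by (simp add: g_def inner_diff_left)
    then obtain \<psi> where "0 \<le> \<psi>" "psd (bordered \<Omega> ((1/2) *\<^sub>R (\<omega> - a + transpose E *v \<psi>)) (t + \<tau> - f \<bullet> \<psi>))"
      using convex_quadratic_multiplier[OF ne bdd \<Omega>] by metis
    with \<phi> \<Omega> cost show ?thesis by blast
  qed auto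
  then obtain t \<omega> \<Omega> \<phi> \<psi> where sol: "\<And>j. j < m \<Longrightarrow>
      t j + \<mu> j \<bullet> \<omega> j + (S j + outer (\<mu> j) (\<mu> j)) \<bullet> \<Omega> j \<le> F j + \<kappa> \<and>
      psd (bordered (\<Omega> j) ((1/2) *\<^sub>R (\<omega> j + transpose E *v \<phi> j)) (t j - f \<bullet> \<phi> j)) \<and>
      psd (bordered (\<Omega> j) ((1/2) *\<^sub>R (\<omega> j - a + transpose E *v \<psi> j)) (t j + \<tau> - f \<bullet> \<psi> j)) \<and>
      psd (\<Omega> j) \<and> 0 \<le> \<phi> j \<and> 0 \<le> \<psi> j" by metis
  let ?cost = "\<lambda>j. t j + \<mu> j \<bullet> \<omega> j + (S j + outer (\<mu> j) (\<mu> j)) \<bullet> \<Omega> j"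
  have "(\<Sum>j<m. \<gamma> j * ?cost j) \<le> (\<Sum>j<m. \<gamma> j * (expect (p j) (g \<tau>) + (\<kappa> + \<kappa>)))"
  proof (intro sum_mono mult_left_mono)
    fix j assume "j \<in> {..<m}"
    then have "?cost j \<le> F j + \<kappa>" "F j - \<kappa> \<le> expect (p j) (g \<tau>)" using sol p(2) by auto
    then show "?cost j \<le> expect (p j) (g \<tau>) + (\<kappa> + \<kappa>)" by linarith
  qed (use \<gamma> in auto)
  also have "\<dots> = (\<Sum>j<m. \<gamma> j * expect (p j) (g \<tau>)) + (\<kappa> + \<kappa>)"
    by (simp only: distrib_left sum.distrib sum_distrib_right[symmetric] \<gamma>(2) mult_1)
  finally have "(1 / \<epsilon>) * (\<Sum>j<m. \<gamma> j * ?cost j)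
    \<le> (1 / \<epsilon>) * ((\<Sum>j<m. \<gamma> j * expect (p j) (g \<tau>)) + (\<kappa> + \<kappa>))"
    using \<epsilon> by (intro mult_left_mono) auto
  also have "\<dots> = G p \<tau> - \<tau> + (1 / \<epsilon>) * (\<kappa> + \<kappa>)" by (simp add: G_def algebra_simps)
  also have "\<dots> \<le> c + \<delta> - \<tau>" using \<tau>[OF p(1)] \<kappa>\<delta> by linarith
  finally have "(\<Sum>j<m. \<gamma> j * ?cost j) \<le> (c + \<delta> - \<tau>) * \<epsilon>"
    using \<epsilon> by (simp add: pos_divide_le_eq)
  \<comment> \<open>Here \<beta> = \<tau> - (c + \<delta>) undoes the substitution \<tau> = \<beta>
    + \<eta>.\<close>
  then have "sdp_feasible E f m \<gamma> \<mu> S a \<epsilon> (c + \<delta>) (\<tau> - (c + \<delta>)) t \<omega> \<Omega> \<phi> \<psi>"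
    using sol by (simp add: sdp_feasible_def algebra_simps)
  then show ?thesis by blast
qed

text \<open>Taking \<Omega> = 0, \<omega> = -E^T \<phi> and t = f . \<phi> makes the first block
  zero, and component i then costs \<gamma>_i \<phi> . (f - E \<mu>_i). Putting the weight of \<phi>
  on a row violated by the mean makes this as negative as desired, for any target
  \<open>\<eta>\<close>.\<close>

lemma sdp_feasible_of_mean_outside:
  fixes E :: "real^'n^'q" and a :: "real^'n"
  assumes ne: "polyhedron_of E f \<noteq> {}" and bdd: "bounded (polyhedron_of E f)" and \<epsilon>: "0 < \<epsilon>"
    and i: "i < m" "0 < \<gamma> i" "\<mu> i \<notin> polyhedron_of E f"
  shows "\<exists>\<beta> t \<omega> \<Omega> \<phi> \<psi>. sdp_feasible E f m \<gamma> \<mu> S a \<epsilon> \<eta> \<beta> t \<omega> \<Omega> \<phi> \<psi>"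
proof -
  obtain r where r: "f $ r < E $ r \<bullet> \<mu> i"
    using i(3) by (auto simp: polyhedron_of_def less_eq_vec_def matrix_vector_mul_component not_le)
  have "bounded ((\<bullet>) a ` polyhedron_of E f)"
    using bdd by (intro bounded_linear_image bounded_linear_inner_right)
  then obtain R where "\<And>x. x \<in> polyhedron_of E f \<Longrightarrow> \<bar>a \<bullet> x\<bar> \<le> R" unfolding bounded_iff by auto
  then have "\<And>x. x \<in> polyhedron_of E f \<Longrightarrow> a \<bullet> x \<le> R" by (simp add: abs_le_iff)
  \<comment> \<open>Writing a = E^T q with q \<ge> 0 lets \<psi> = \<phi> + q cancel the linear part
    of the second block; the choice of \<open>\<beta>\<close> below cancels its corner.\<close>
  then obtain q where q: "0 \<le> q" "transpose E *v q = a" using affine_farkas[OF ne] by metis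
  define \<beta> where "\<beta> = f \<bullet> q - \<eta>"
  \<comment> \<open>Scaled so that the total cost is exactly -|\<epsilon>\<beta>|, which offsets the
    term \<epsilon>\<beta> of the cost row.\<close>
  define s where "s = \<bar>\<epsilon> * \<beta>\<bar> / (\<gamma> i * (E $ r \<bullet> \<mu> i - f $ r))"
  have s: "0 \<le> s" using i r by (simp add: s_def)
  define \<phi> :: "nat \<Rightarrow> real^'q" where "\<phi> = (\<lambda>j. if j = i then s *\<^sub>R axis r 1 else 0)"
  have \<phi>: "0 \<le> \<phi> j" for j using s by (simp add: \<phi>_def less_eq_vec_def axis_def)
  have b0: "bordered 0 0 0 = 0" by (simp add: bordered_def vec_eq_iff split: sum.split)
  have "(\<Sum>j<m. \<gamma> j * (f \<bullet> \<phi> j + \<mu> j \<bullet> (- (transpose E *v \<phi> j)) + (S j + outer (\<mu> j) (\<mu> j)) \<bullet> 0))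
    = (\<Sum>j<m. if j = i then \<gamma> i * (s * (f $ r - E $ r \<bullet> \<mu> i)) else 0)"
  proof (intro sum.cong refl)
    fix j
    have "\<mu> i \<bullet> (transpose E *v axis r 1) = E $ r \<bullet> \<mu> i"
      unfolding inner_commute[of "\<mu> i"] transpose_mult_vec_inner
      by (simp add: inner_axis' matrix_vector_mul_component)
    then show "\<gamma> j * (f \<bullet> \<phi> j + \<mu> j \<bullet> (- (transpose E *v \<phi> j)) + (S j + outer (\<mu> j) (\<mu> j)) \<bullet> 0)
      = (if j = i then \<gamma> i * (s * (f $ r - E $ r \<bullet> \<mu> i)) else 0)"
      by (simp add: \<phi>_def matrix_vector_mult_scaleR inner_axis algebra_simps
          del: transpose_matrix_vector)
  qed
  also have "\<dots> = - (s * (\<gamma> i * (E $ r \<bullet> \<mu> i - f $ r)))" using i(1) by (simp add: algebra_simps)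
  also have "s * (\<gamma> i * (E $ r \<bullet> \<mu> i - f $ r)) = \<bar>\<epsilon> * \<beta>\<bar>" using i r by (simp add: s_def)
  finally have "sdp_feasible E f m \<gamma> \<mu> S a \<epsilon> \<eta> \<beta> (\<lambda>j. f \<bullet> \<phi> j) (\<lambda>j. - (transpose E *v \<phi> j))
    (\<lambda>_. 0) \<phi> (\<lambda>j. \<phi> j + q)"
    using \<phi> q(1)
    by (simp add: sdp_feasible_def b0 \<beta>_def inner_add_right q(2) matrix_vector_right_distrib
        del: transpose_matrix_vector)
  then show ?thesis by blast
qed

text \<open>Both sides may be minus infinity, so they are compared through real bounds
  \<open>c\<close>. The assumption \<open>comp\<close> concerns weight 0: an empty component of that
  kind would empty the ambiguity set but leave no trace in the cost row. With it, a mean outside the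
  polyhedron must carry positive weight.\<close>

lemma sup_CVaR_le_iff_sdp_value_le:
  fixes E :: "real^'n^'q" and a :: "real^'n"
  assumes ne: "polyhedron_of E f \<noteq> {}" and bdd: "bounded (polyhedron_of E f)"
    and \<epsilon>: "0 < \<epsilon>" "\<epsilon> < 1"
    and \<gamma>: "\<And>j. j < m \<Longrightarrow> 0 \<le> \<gamma> j" "(\<Sum>j<m. \<gamma> j) = 1"
    and S: "\<And>j. j < m \<Longrightarrow> psd (S j)"
    and comp: "\<And>j. j < m \<Longrightarrow> \<gamma> j = 0 \<Longrightarrow> component_set (polyhedron_of E f) (\<mu> j) (S j) \<noteq> {}"
  shows "(SUP P \<in> ambiguity_set (polyhedron_of E f) m \<gamma> \<mu> S. CVaR P \<epsilon> (\<lambda>\<xi>. a \<bullet> \<xi>)) \<le> ereal c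
    \<longleftrightarrow> sdp_value E f m \<gamma> \<mu> S a \<epsilon> \<le> ereal c"
proof
  let ?W = "polyhedron_of E f"
  let ?v = "sdp_value E f m \<gamma> \<mu> S a \<epsilon>"
  assume "(SUP P \<in> ambiguity_set ?W m \<gamma> \<mu> S. CVaR P \<epsilon> (\<lambda>\<xi>. a \<bullet> \<xi>)) \<le> ereal c"
  then have CV: "\<And>P. P \<in> ambiguity_set ?W m \<gamma> \<mu> S \<Longrightarrow> CVaR P \<epsilon> (\<lambda>\<xi>. a \<bullet> \<xi>) \<le> ereal c"
    by (simp add: SUP_le_iff)
  have feas: "\<exists>\<beta> t \<omega> \<Omega> \<phi> \<psi>. sdp_feasible E f m \<gamma> \<mu> S a \<epsilon> (c + \<delta>) \<beta> t \<omega> \<Omega> \<phi> \<psi>"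
    if \<delta>: "0 < \<delta>" for \<delta>
  proof (cases "\<forall>j<m. \<mu> j \<in> ?W")
    case True
    show ?thesis
    proof (intro CVaR_le_imp_sdp_feasible[where m = m])
      show "\<mu> j \<in> ?W" if "j < m" for j using True that by simp
      show "CVaR P \<epsilon> (\<lambda>\<xi>. a \<bullet> \<xi>) \<le> ereal c" if "P \<in> ambiguity_set ?W m \<gamma> \<mu> S" for P
        by (rule CV[OF that])
    qed (rule bdd \<epsilon> \<gamma> S \<delta> | assumption)+
  next
    case False
    then obtain i where i: "i < m" "\<mu> i \<notin> ?W" by blast
    have "component_set ?W (\<mu> i) (S i) = {}"
      using i(2) component_mean_in[OF bdd, of _ "\<mu> i" "S i"] by auto
    then have "\<gamma> i \<noteq> 0" using comp[OF i(1)] by auto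
    then have "0 < \<gamma> i" using \<gamma>(1)[OF i(1)] by simp
    then show ?thesis
      using sdp_feasible_of_mean_outside[where \<gamma> = \<gamma> and \<mu> = \<mu> and i = i] ne bdd \<epsilon>(1) i by simp
  qed
  have "?v \<le> ereal (c + \<delta>)" if "0 < \<delta>" for \<delta>
    unfolding sdp_value_def by (intro Inf_lower imageI CollectI feas that)
  then show "?v \<le> ereal c" by (simp add: ereal_le_epsilon2)
next
  assume le: "sdp_value E f m \<gamma> \<mu> S a \<epsilon> \<le> ereal c"
  have "CVaR P \<epsilon> (\<lambda>\<xi>. a \<bullet> \<xi>) \<le> sdp_value E f m \<gamma> \<mu> S a \<epsilon>"
    if "P \<in> ambiguity_set (polyhedron_of E f) m \<gamma> \<mu> S" for P
    unfolding sdp_value_def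
  proof (rule Inf_greatest, elim imageE CollectE exE)
    fix y \<eta> \<beta> t \<omega> \<Omega> \<phi> \<psi>
    assume y: "y = ereal \<eta>" and feas: "sdp_feasible E f m \<gamma> \<mu> S a \<epsilon> \<eta> \<beta> t \<omega> \<Omega> \<phi> \<psi>"
    show "CVaR P \<epsilon> (\<lambda>\<xi>. a \<bullet> \<xi>) \<le> y"
      unfolding y by (rule sdp_feasible_imp_CVaR_le[OF bdd \<epsilon>(1) \<gamma>(1) that feas])
  qed
  then show "(SUP P \<in> ambiguity_set (polyhedron_of E f) m \<gamma> \<mu> S. CVaR P \<epsilon> (\<lambda>\<xi>. a \<bullet> \<xi>)) \<le> ereal c"
    using order_trans[OF _ le] by (simp add: SUP_le_iff)
qed

section \<open>Tightened constraints\<close>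

text \<open>A linear map distributes over Minkowski sums, and applying \<Phi> raises each power by
  one. For l = 0 both sides are {0}.\<close>

lemma image_sum_mat_power:
  fixes \<Phi> :: "real^'n^'n"
  shows "(\<Sum>i=1..l. (*v) (mat_power \<Phi> i) ` W) = (*v) \<Phi> ` (\<Sum>i<l. (*v) (mat_power \<Phi> i) ` W)"
proof (induction l)
  case 0
  show ?case by (simp add: set_zero)
next
  case (Suc l)
  have "(*v) \<Phi> ` (A + B) = (*v) \<Phi> ` A + (*v) \<Phi> ` B" for A B :: "(real^'n) set"
    by (force simp: set_plus_def matrix_vector_right_distrib image_iff)
  moreover have "(*v) (mat_power \<Phi> (Suc l)) ` W = (*v) \<Phi> ` (*v) (mat_power \<Phi> l) ` W"
    by (simp add: image_image matrix_vector_mul_assoc)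
  ultimately show ?case using Suc by simp
qed

theorem theorem1:
  fixes A :: "real^'n^'n" and B :: "real^'u^'n" and K :: "real^'n^'u" and \<Phi> :: "real^'n^'n"
    and E :: "real^'n^'q" and f :: "real^'q" and W :: "(real^'n) set"
    and H :: "real^'n^'p" and h \<epsilon> :: "real^'p"
    and x w :: "nat \<Rightarrow> real^'n" and u :: "nat \<Rightarrow> real^'u"
    and z :: "nat \<Rightarrow> nat \<Rightarrow> real^'n" and v :: "nat \<Rightarrow> nat \<Rightarrow> real^'u"
    and m :: "nat \<Rightarrow> nat" and \<gamma> :: "nat \<Rightarrow> nat \<Rightarrow> real"
    and \<mu> :: "nat \<Rightarrow> nat \<Rightarrow> real^'n" and S :: "nat \<Rightarrow> nat \<Rightarrow> real^'n^'n"
    and k l :: nat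
  assumes "controllable A B"
    and "\<Phi> = A + B ** K" and "schur_stable \<Phi>"
    and "W = polyhedron_of E f" and "bounded W" and "0 \<in> interior W"
    and "\<And>k. w k \<in> W" and "\<And>k. x (Suc k) = A *v x k + B *v u k + w k"
    and "\<And>k. z k 0 = x k" and "\<And>k l. z k (Suc l) = A *v z k l + B *v v k l"
    and "\<And>i. 0 < \<epsilon> $ i \<and> \<epsilon> $ i < 1"
    and "\<And>j. j < m k \<Longrightarrow> 0 \<le> \<gamma> k j" and "(\<Sum>j<m k. \<gamma> k j) = 1"
    and "\<And>j. j < m k \<Longrightarrow> psd (S k j)"
    and "\<And>j. j < m k \<Longrightarrow> \<gamma> k j = 0 \<Longrightarrow> component_set W (\<mu> k j) (S k j) \<noteq> {}"
  shows "(\<forall>e \<in> (\<Sum>i<l. (*v) (mat_power \<Phi> i) ` W). \<forall>i.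
            (SUP P \<in> ambiguity_set W (m k) (\<gamma> k) (\<mu> k) (S k).
               CVaR P (\<epsilon> $ i) (\<lambda>\<xi>. (H *v (z k (Suc l) + \<Phi> *v e + \<xi>)) $ i - h $ i)) \<le> 0)
         \<longleftrightarrow>
         z k (Suc l) \<in> pontryagin_diff
           (tightened_set H h (\<lambda>i. sdp_value E f (m k) (\<gamma> k) (\<mu> k) (S k) (H $ i) (\<epsilon> $ i)))
           (\<Sum>i=1..l. (*v) (mat_power \<Phi> i) ` W)"
proof -
  let ?Z = "z k (Suc l)"
  let ?D = "ambiguity_set W (m k) (\<gamma> k) (\<mu> k) (S k)"
  let ?v = "\<lambda>i. sdp_value E f (m k) (\<gamma> k) (\<mu> k) (S k) (H $ i) (\<epsilon> $ i)"
  have ne: "polyhedron_of E f \<noteq> {}" using assms(4,6) interior_subset by blast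
  \<comment> \<open>For fixed \<open>e\<close> and \<open>i\<close> the loss is a linear function of
    the disturbance plus the constant \<open>?d\<close>, which translation moves into the bound. The
    equivalence is pointwise in \<open>e\<close>, so both sides of the theorem become the same
    quantification over the error tube.\<close>
  have key: "(SUP P \<in> ?D. CVaR P (\<epsilon> $ i) (\<lambda>\<xi>. (H *v (?Z + \<Phi> *v e + \<xi>)) $ i - h $ i)) \<le> 0
    \<longleftrightarrow> ereal ((H *v (?Z + \<Phi> *v e)) $ i) \<le> ereal (h $ i) - ?v i" for e i
  proof -
    let ?d = "(H *v (?Z + \<Phi> *v e)) $ i - h $ i"
    have "(\<lambda>\<xi>. (H *v (?Z + \<Phi> *v e + \<xi>)) $ i - h $ i) = (\<lambda>\<xi>. H $ i \<bullet> \<xi> + ?d)"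
      by (simp add: fun_eq_iff matrix_vector_mul_component inner_add_right)
    then have "(SUP P \<in> ?D. CVaR P (\<epsilon> $ i) (\<lambda>\<xi>. (H *v (?Z + \<Phi> *v e + \<xi>)) $ i - h $ i)) \<le> 0
      \<longleftrightarrow> (\<forall>P\<in>?D. CVaR P (\<epsilon> $ i) (\<lambda>\<xi>. H $ i \<bullet> \<xi> + ?d) \<le> ereal (- ?d + ?d))"
      by (simp add: SUP_le_iff zero_ereal_def)
    also have "\<dots> \<longleftrightarrow> (SUP P \<in> ?D. CVaR P (\<epsilon> $ i) (\<lambda>\<xi>. H $ i \<bullet> \<xi>)) \<le> ereal (- ?d)"
      unfolding CVaR_shift by (simp add: SUP_le_iff)
    also have "\<dots> \<longleftrightarrow> ?v i \<le> ereal (- ?d)"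
      using assms(5,11-15) ne unfolding assms(4)
      by (intro sup_CVaR_le_iff_sdp_value_le) auto
    also have "\<dots> \<longleftrightarrow> ereal ((H *v (?Z + \<Phi> *v e)) $ i) \<le> ereal (h $ i) - ?v i"
      \<comment> \<open>The value may be infinite: at minus infinity both inequalities hold, at plus
        infinity both fail.\<close>
      by (cases "?v i") auto
    finally show ?thesis .
  qed
  show ?thesis
    unfolding key image_sum_mat_power pontryagin_diff_def tightened_set_def
    by (auto simp: set_plus_def)
qed

end
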